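(* Let $\sigma>1$ be an integer, $\omega$ a primitive $\sigma$-th root of unity, $G$ a matrix of rank $r$ with column set $E$, and $\mathbb{A}$ of order $q$, in the setting described in the context. For $k=0,\dots,\sigma-1$ let $\mathcal{O}(k,\sigma)$ be the set of pairs $(f,g)$ of functions $f,g:E\to\mathbb{A}$ such that $f-g$ is a flow of $G$ over $\mathbb{A}$ and $|\mathrm{supp}(f-g)|\equiv k\pmod\sigma$. Then $$\sum_{k=0}^{\sigma-1}\omega^k|\mathcal{O}(k,\sigma)| = \omega^{|E|-r}(1-\omega)^r q^{|E|}\,R\!\left(M(G);\frac{q\omega}{1-\omega},\frac{1-\omega}{\omega}\right).$$
   Context: Setting (the paper's hypothesis "$G$ is a totally-$\mathbb{P}$ matrix and $\mathbb{A}$ a $\mathbb{P}$-module of order $q$", read as the following cases): either (i) $G$ is the vertex–edge or cycle–edge matrix of a graph with edge set $E$, or a totally unimodular matrix, and $\mathbb{A}$ is an Abelian group of order $q$; or (ii) $G$ is a matrix over $\mathrm{GF}(p^s)$, $\mathbb{A}=\mathrm{GF}(p^s)^d$, $q=p^{sd}$. With $H$ a matrix orthogonally dual to $G$ (same columns, rows of $H$ orthogonal to rows of $G$, ranks summing to $|E|$; integer in case (i)), a flow of $G$ over $\mathbb{A}$ is $h:E\to\mathbb{A}$ with $Hh^T=0$ (equivalently an $\mathbb{A}$-combination of rows of $G$). $\mathrm{supp}(f)=\{e: f(e)\ne0\}$. $M(G)$ is the matroid on $E$ given by linear dependence of the columns of $G$, with rank function $\mathrm{rk}$ and rank $r$;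 its rank generating polynomial is $R(M;\lambda,x)=\sum_{B\subseteq E}\lambda^{r-\mathrm{rk}(B)}x^{|B|-\mathrm{rk}(B)}$. *)

theory Defs
  imports
    "HOL-Analysis.Finite_Cartesian_Product"
    "HOL-Library.FuncSet"
    "HOL-Number_Theory.Cong"
    "Jordan_Normal_Form.Determinant"
    "Graph_Theory.Digraph"
begin

text \<open>
  A matrix with finite row set \<open>I\<close> and finite column set \<open>E\<close> is a function \<open>G\<close> whose entry in
  row \<open>i \<in> I\<close> and column \<open>e \<in> E\<close> is \<open>G i e\<close>; values outside \<open>I \<times> E\<close> are irrelevant.
  A matroid on \<open>E\<close> is given by its predicate of independent sets.
\<close>

definition primitive_root_of_unity :: "nat \<Rightarrow> complex \<Rightarrow> bool" where
  "primitive_root_of_unity n w \<longleftrightarrow> w ^ n = 1 \<and> (\<forall>j. 0 < j \<and> j < n \<longrightarrow> w ^ j \<noteq> 1)"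


subsection \<open>Matroids of matrices and the rank generating polynomial\<close>

text \<open>
  Independence is that of the family of columns indexed by \<open>S\<close>, so two equal columns with
  different indices are dependent.
\<close>

definition column_matroid :: "'i set \<Rightarrow> ('i \<Rightarrow> 'e \<Rightarrow> 'k::field) \<Rightarrow> 'e set \<Rightarrow> bool" where
  "column_matroid I G S \<longleftrightarrow>
     (\<forall>c. (\<forall>i\<in>I. (\<Sum>e\<in>S. c e * G i e) = 0) \<longrightarrow> (\<forall>e\<in>S. c e = 0))"

definition matroid_rank :: "('e set \<Rightarrow> bool) \<Rightarrow> 'e set \<Rightarrow> nat" where
  "matroid_rank indep B = Max (card ` {S. S \<subseteq> B \<and> indep S})"

definition mat_rank :: "'i set \<Rightarrow> 'e set \<Rightarrow> ('i \<Rightarrow> 'e \<Rightarrow> 'k::field) \<Rightarrow> nat" where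
  "mat_rank I E G = matroid_rank (column_matroid I G) E"

text \<open>The exponents are never truncated, as \<open>rk B \<le> rk E\<close> and \<open>rk B \<le> card B\<close> for \<open>B \<subseteq> E\<close>.\<close>

definition rank_gen_poly :: "'e set \<Rightarrow> ('e set \<Rightarrow> bool) \<Rightarrow> complex \<Rightarrow> complex \<Rightarrow> complex" where
  "rank_gen_poly E indep l x =
     (\<Sum>B\<in>Pow E. l ^ (matroid_rank indep E - matroid_rank indep B)
                 * x ^ (card B - matroid_rank indep B))"

definition rat_mat :: "('i \<Rightarrow> 'e \<Rightarrow> int) \<Rightarrow> 'i \<Rightarrow> 'e \<Rightarrow> rat" where
  "rat_mat G = (\<lambda>i e. of_int (G i e))"


subsection \<open>Integer matrices to which every Abelian group is admitted\<close>

definition totally_unimodular :: "'i set \<Rightarrow> 'e set \<Rightarrow> ('i \<Rightarrow> 'e \<Rightarrow> int) \<Rightarrow> bool" where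
  "totally_unimodular I E G \<longleftrightarrow>
     (\<forall>n (a :: nat \<Rightarrow> 'i) (b :: nat \<Rightarrow> 'e).
        inj_on a {..<n} \<and> a ` {..<n} \<subseteq> I \<and> inj_on b {..<n} \<and> b ` {..<n} \<subseteq> E \<longrightarrow>
        Determinant.det (mat n n (\<lambda>(s, t). G (a s) (b t))) \<in> {-1, 0, 1})"

text \<open>
  A graph (loops and parallel edges allowed) carries an arbitrary reference orientation, so it is
  given as a finite directed multigraph; its edges are the columns. In the vertex-edge matrix the
  column of a loop is zero.
\<close>

definition vertex_edge_matrix :: "'i set \<Rightarrow> 'e set \<Rightarrow> ('i \<Rightarrow> 'e \<Rightarrow> int) \<Rightarrow> bool" where
  "vertex_edge_matrix I E G \<longleftrightarrow>
     (\<exists>D :: ('i, 'e) pre_digraph. fin_digraph D \<and> verts D = I \<and> arcs D = E \<and>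
        (\<forall>v\<in>I. \<forall>e\<in>E. G v e = (if head D e = v then 1 else 0) - (if tail D e = v then 1 else 0)))"

text \<open>
  A cycle of the underlying undirected multigraph is listed as the steps \<open>(e, fwd)\<close> of a closed
  walk, where \<open>fwd\<close> says whether \<open>e\<close> is traversed from tail to head. A loop is a cycle of
  length 1, two parallel edges form a cycle of length 2.
\<close>

definition step_from :: "('v, 'e) pre_digraph \<Rightarrow> 'e \<times> bool \<Rightarrow> 'v" where
  "step_from D s = (if snd s then tail D (fst s) else head D (fst s))"

definition step_to :: "('v, 'e) pre_digraph \<Rightarrow> 'e \<times> bool \<Rightarrow> 'v" where
  "step_to D s = (if snd s then head D (fst s) else tail D (fst s))"

definition is_cycle :: "('v, 'e) pre_digraph \<Rightarrow> ('e \<times> bool) list \<Rightarrow> bool" where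
  "is_cycle D c \<longleftrightarrow> c \<noteq> [] \<and> fst ` set c \<subseteq> arcs D \<and>
     distinct (map fst c) \<and> distinct (map (step_from D) c) \<and>
     (\<forall>i<length c. step_to D (c ! i) = step_from D (c ! (Suc i mod length c)))"

definition cycle_vector :: "('e \<times> bool) list \<Rightarrow> 'e \<Rightarrow> int" where
  "cycle_vector c e = (if (e, True) \<in> set c then 1 else if (e, False) \<in> set c then -1 else 0)"

text \<open>
  There is one row for every cycle, with one of its two directions of traversal chosen
  arbitrarily: a cycle is determined up to traversal by its edge set. Taking the vertices of the
  finite graph to be natural numbers is no restriction.
\<close>

definition cycle_edge_matrix :: "'i set \<Rightarrow> 'e set \<Rightarrow> ('i \<Rightarrow> 'e \<Rightarrow> int) \<Rightarrow> bool" where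
  "cycle_edge_matrix I E G \<longleftrightarrow>
     (\<exists>(D :: (nat, 'e) pre_digraph) (C :: 'i \<Rightarrow> ('e \<times> bool) list).
        fin_digraph D \<and> arcs D = E \<and>
        (\<forall>i\<in>I. is_cycle D (C i)) \<and>
        bij_betw (\<lambda>i. fst ` set (C i)) I {fst ` set c | c. is_cycle D c} \<and>
        (\<forall>i\<in>I. \<forall>e\<in>E. G i e = cycle_vector (C i) e))"


subsection \<open>Flows\<close>

definition orthogonally_dual ::
  "'i set \<Rightarrow> 'j set \<Rightarrow> 'e set \<Rightarrow> ('i \<Rightarrow> 'e \<Rightarrow> 'k::field) \<Rightarrow> ('j \<Rightarrow> 'e \<Rightarrow> 'k) \<Rightarrow> bool" where
  "orthogonally_dual I J E G H \<longleftrightarrow>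
     (\<forall>i\<in>I. \<forall>j\<in>J. (\<Sum>e\<in>E. G i e * H j e) = 0) \<and> mat_rank I E G + mat_rank J E H = card E"

definition int_smult :: "int \<Rightarrow> 'a::ab_group_add \<Rightarrow> 'a" where
  "int_smult m x = (if 0 \<le> m then (\<Sum>i<nat m. x) else - (\<Sum>i<nat (- m). x))"

text \<open>
  A flow \<open>h\<close> of \<open>G\<close> satisfies \<open>H h\<^sup>T = 0\<close> for the orthogonally dual matrices \<open>H\<close> of \<open>G\<close>. The
  quantifier over \<open>H\<close> (whose finitely many rows are numbered) makes this depend on \<open>G\<close> only. Over a
  field all \<open>H\<close> impose the same condition. Over an Abelian group they need not: if \<open>H\<close> is an
  integer dual then so is \<open>2 H\<close>, which imposes no condition at all on \<open>h\<close> with values in a group of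
  exponent 2. The condition for all integer \<open>H\<close> is the one imposed by any single totally unimodular
  dual \<open>H\<close>, or by the cycle-edge matrix of a graph as dual of its vertex-edge matrix, and
  conversely. For the integer matrices \<open>G\<close> of the three kinds above, the flows are precisely the
  combinations of the rows of \<open>G\<close> with coefficients in the group.
\<close>

definition group_flow ::
  "'i set \<Rightarrow> 'e set \<Rightarrow> ('i \<Rightarrow> 'e \<Rightarrow> int) \<Rightarrow> ('e \<Rightarrow> 'a::ab_group_add) \<Rightarrow> bool" where
  "group_flow I E G h \<longleftrightarrow>
     (\<forall>n (H :: nat \<Rightarrow> 'e \<Rightarrow> int). orthogonally_dual I {..<n} E (rat_mat G) (rat_mat H) \<longrightarrow>
        (\<forall>j<n. (\<Sum>e\<in>E. int_smult (H j e) (h e)) = 0))"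

definition field_flow ::
  "'i set \<Rightarrow> 'e set \<Rightarrow> ('i \<Rightarrow> 'e \<Rightarrow> 'k::field) \<Rightarrow> ('e \<Rightarrow> 'k ^ 'd) \<Rightarrow> bool" where
  "field_flow I E G h \<longleftrightarrow>
     (\<forall>n (H :: nat \<Rightarrow> 'e \<Rightarrow> 'k). orthogonally_dual I {..<n} E G H \<longrightarrow>
        (\<forall>j<n. (\<Sum>e\<in>E. H j e *s h e) = 0))"

definition supp :: "'e set \<Rightarrow> ('e \<Rightarrow> 'a::zero) \<Rightarrow> 'e set" where
  "supp E h = {e \<in> E. h e \<noteq> 0}"

definition flow_pairs ::
  "'e set \<Rightarrow> (('e \<Rightarrow> 'a::ab_group_add) \<Rightarrow> bool) \<Rightarrow> nat \<Rightarrow> nat \<Rightarrow> (('e \<Rightarrow> 'a) \<times> ('e \<Rightarrow> 'a)) set" where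
  "flow_pairs E flow k \<sigma> =
     {(f, g). f \<in> E \<rightarrow>\<^sub>E UNIV \<and> g \<in> E \<rightarrow>\<^sub>E UNIV \<and>
        flow (\<lambda>e. f e - g e) \<and> [card (supp E (\<lambda>e. f e - g e)) = k] (mod \<sigma>)}"

end

theory Submission imports Defs begin

text \<open>
  Substituting \<open>h = f - g\<close> turns the left-hand side into \<open>q ^ card E\<close> times the sum of
  \<open>\<omega> ^ card (supp h)\<close> over all flows \<open>h\<close>. Expanding the weight of \<open>h\<close> as the product over the
  edges \<open>e\<close> of \<open>\<omega> + (1 - \<omega>) [h e = 0]\<close> reduces the claim to counting the flows that vanish on a
  set \<open>B\<close>: there are \<open>q ^ (r - rk B)\<close> of them.

  Let \<open>S\<close> be a column basis extending a basis of \<open>B\<close>. If every column is a combination of \<open>S\<close> with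
  coefficients in the ring acting on the group (all of the field, respectively the integers), then
  a flow is determined by its arbitrary values on \<open>S\<close>, and it vanishes on \<open>B\<close> iff it vanishes on
  the basis of \<open>B\<close>. It remains to show that the coefficients are integral. For a totally unimodular
  matrix this is Cramer's rule, and for graphs it is a combinatorial argument; the matrix of all
  cycles of a graph is not totally unimodular in general.
\<close>

subsection \<open>Column bases\<close>

text \<open>Gaussian elimination: an equation with a nonzero coefficient at some unknown
  \<open>u\<close> is solved for \<open>u\<close> and substituted into the others, at the cost of
  one equation and one unknown.\<close>

lemma homogeneous_system_nontrivial:
  fixes a :: "'s \<Rightarrow> 't \<Rightarrow> 'k::field"
  assumes "finite S" "finite T" "card S < card T"
  shows "\<exists>c. (\<exists>t\<in>T. c t \<noteq> 0) \<and> (\<forall>s\<in>S. (\<Sum>t\<in>T. c t * a s t) = 0)"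
  using assms
proof (induction S arbitrary: T a rule: finite_induct)
  case empty
  then obtain t where "t \<in> T" by fastforce
  then show ?case by (intro exI[of _ "\<lambda>_. 1"]) auto
next
  case (insert s S)
  show ?case
  proof (cases "\<forall>t\<in>T. a s t = 0")
    case True
    moreover obtain c where "\<exists>t\<in>T. c t \<noteq> 0" "\<forall>s\<in>S. (\<Sum>t\<in>T. c t * a s t) = 0"
      using insert.IH[of T a] insert.prems insert.hyps by auto
    ultimately show ?thesis by (intro exI[of _ c]) auto
  next
    case False
    then obtain u where u: "u \<in> T" "a s u \<noteq> 0" by blast
    define T' where "T' = T - {u}"
    have T': "T = insert u T'" "u \<notin> T'" "finite T'" "card S < card T'"
      using u insert by (auto simp: T'_def)
    \<comment> \<open>These are the coefficients of the remaining equations after \<open>u\<close>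
      has been eliminated; \<open>- b\<close> below is the value that equation \<open>s\<close> then
      forces on \<open>u\<close>.\<close>
    obtain c where c: "\<exists>t\<in>T'. c t \<noteq> 0"
      "\<forall>r\<in>S. (\<Sum>t\<in>T'. c t * (a r t - a r u * a s t / a s u)) = 0"
      using insert.IH[OF T'(3,4), of "\<lambda>r t. a r t - a r u * a s t / a s u"] by auto
    define b where "b = (\<Sum>t\<in>T'. c t * a s t) / a s u"
    define c' where "c' = c(u := - b)"
    have sum: "(\<Sum>t\<in>T. c' t * a r t) = (\<Sum>t\<in>T'. c t * a r t) - b * a r u" for r
    proof -
      have "(\<Sum>t\<in>T'. c' t * a r t) = (\<Sum>t\<in>T'. c t * a r t)"
        using T' by (intro sum.cong) (auto simp: c'_def)
      then show ?thesis using T' by (simp add: c'_def)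
    qed
    have "(\<Sum>t\<in>T. c' t * a r t) = 0" if "r \<in> S" for r
    proof -
      have "(\<Sum>t\<in>T'. c t * (a r t - a r u * a s t / a s u)) = (\<Sum>t\<in>T'. c t * a r t) - b * a r u"
        by (simp add: b_def right_diff_distrib sum_subtractf sum_distrib_right sum_divide_distrib
            mult.assoc mult.commute[of "a r u"])
      then show ?thesis using bspec[OF c(2) that] sum[of r] by argo
    qed
    moreover have "(\<Sum>t\<in>T. c' t * a s t) = 0"
      using u sum[of s] by (simp add: b_def)
    moreover have "\<exists>t\<in>T. c' t \<noteq> 0"
      using c(1) T' by (auto simp: c'_def)
    ultimately show ?thesis by (intro exI[of _ c']) auto
  qed
qed

lemma column_matroid_subset:
  assumes "column_matroid I G S" "T \<subseteq> S" "finite S"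
  shows "column_matroid I G T"
  unfolding column_matroid_def
proof (intro allI impI)
  fix c assume c: "\<forall>i\<in>I. (\<Sum>e\<in>T. c e * G i e) = 0"
  define c' where "c' = (\<lambda>e. if e \<in> T then c e else 0)"
  have "(\<Sum>e\<in>S. c' e * G i e) = (\<Sum>e\<in>T. c e * G i e)" for i
    using assms by (intro sum.mono_neutral_cong_right) (auto simp: c'_def)
  then have "\<forall>e\<in>S. c' e = 0"
    using assms(1) c unfolding column_matroid_def by auto
  then show "\<forall>e\<in>T. c e = 0"
    using assms(2) unfolding c'_def by (metis subsetD)
qed

lemma column_matroid_unique_coeffs:
  assumes "column_matroid I G S"
    and "\<forall>i\<in>I. (\<Sum>s\<in>S. c s * G i s) = (\<Sum>s\<in>S. d s * G i s)" "s \<in> S"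
  shows "c s = d s"
proof -
  have "\<forall>i\<in>I. (\<Sum>s\<in>S. (c s - d s) * G i s) = 0"
    using assms(2) by (simp add: algebra_simps sum_subtractf)
  then have "\<forall>s\<in>S. c s - d s = 0"
    using assms(1)[unfolded column_matroid_def, rule_format, of "\<lambda>s. c s - d s"] by blast
  then show ?thesis using assms(3) by auto
qed

text \<open>A dependency of the enlarged set has a nonzero coefficient at \<open>e\<close>, since
  \<open>S\<close> is independent, so it can be solved for column \<open>e\<close>.\<close>

lemma column_matroid_not_insert:
  assumes "column_matroid I G S" "finite S" "e \<notin> S" "\<not> column_matroid I G (insert e S)"
  shows "\<exists>d. \<forall>i\<in>I. G i e = (\<Sum>s\<in>S. d s * G i s)"
proof -
  obtain c where c: "\<forall>i\<in>I. (\<Sum>x\<in>insert e S. c x * G i x) = 0" "\<exists>x\<in>insert e S. c x \<noteq> 0"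
    using assms(4) unfolding column_matroid_def by blast
  have eq: "\<forall>i\<in>I. c e * G i e + (\<Sum>x\<in>S. c x * G i x) = 0"
    using c(1) assms by simp
  have "c e \<noteq> 0"
  proof
    assume "c e = 0"
    with eq assms(1) have "\<forall>x\<in>S. c x = 0" unfolding column_matroid_def by simp
    with c(2) \<open>c e = 0\<close> show False by auto
  qed
  have "G i e = (\<Sum>s\<in>S. (- c s / c e) * G i s)" if "i \<in> I" for i
  proof -
    have "c e * G i e = - (\<Sum>x\<in>S. c x * G i x)"
      using eq[rule_format, OF that] by (rule eq_neg_iff_add_eq_0[THEN iffD2])
    then have "G i e = - (\<Sum>x\<in>S. c x * G i x) / c e"
      using \<open>c e \<noteq> 0\<close> by (simp add: field_simps)
    also have "\<dots> = (\<Sum>s\<in>S. (- c s / c e) * G i s)"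
      by (simp add: sum_divide_distrib flip: sum_negf)
    finally show ?thesis .
  qed
  then show ?thesis by (intro exI[of _ "\<lambda>s. - c s / c e"] ballI)
qed

lemma sum_delta_mult:
  fixes g :: "'e \<Rightarrow> 'r::semiring_1"
  assumes "finite S" "e \<in> S"
  shows "(\<Sum>s\<in>S. (if s = e then 1 else 0) * g s) = g e"
  using assms by (simp add: if_distrib[of "\<lambda>x. x * _"] cong: if_cong)

text \<open>An independent set that is maximal between \<open>S0\<close> and \<open>B\<close> spans
  \<open>B\<close>, as any column of \<open>B\<close> outside its span could be added. The
  prescribed \<open>S0\<close> serves to extend a basis of a subset to a basis of all
  columns.\<close>

lemma column_basis_extend:
  assumes "column_matroid I G S0" "S0 \<subseteq> B" "finite B"
  obtains S where "S0 \<subseteq> S" "S \<subseteq> B" "column_matroid I G S"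
    "\<forall>e\<in>B. \<exists>d. \<forall>i\<in>I. G i e = (\<Sum>s\<in>S. d s * G i s)"
proof -
  let ?X = "{S. S0 \<subseteq> S \<and> S \<subseteq> B \<and> column_matroid I G S}"
  have "finite ?X" using assms(3) by (auto intro: finite_subset[of _ "Pow B"])
  moreover have "S0 \<in> ?X" using assms by auto
  ultimately obtain S where S: "S \<in> ?X" "\<forall>T\<in>?X. S \<subseteq> T \<longrightarrow> S = T"
    using finite_has_maximal[of ?X] by blast
  have fin: "finite S" using S(1) assms(3) finite_subset by blast
  have "\<exists>d. \<forall>i\<in>I. G i e = (\<Sum>s\<in>S. d s * G i s)" if "e \<in> B" for e
  proof (cases "e \<in> S")
    case True
    then show ?thesis
      using fin by (intro exI[of _ "\<lambda>s. if s = e then 1 else 0"]) (simp add: sum_delta_mult)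
  next
    case False
    then have "\<not> column_matroid I G (insert e S)"
      using S that by blast
    with False fin S(1) show ?thesis
      by (intro column_matroid_not_insert) auto
  qed
  with S(1) show thesis by (intro that[of S]) simp_all
qed

text \<open>If \<open>T\<close> were larger than \<open>S\<close>, the coordinate vectors of its
  columns with respect to \<open>S\<close> would satisfy a nontrivial linear relation, which the
  columns themselves would inherit.\<close>

lemma card_independent_le_spanning:
  assumes "column_matroid I G T" "finite S" "finite T"
    and "\<forall>e\<in>T. \<exists>d. \<forall>i\<in>I. G i e = (\<Sum>s\<in>S. d s * G i s)"
  shows "card T \<le> card S"
proof (rule ccontr)
  assume "\<not> card T \<le> card S"
  obtain d where d: "\<forall>e\<in>T. \<forall>i\<in>I. G i e = (\<Sum>s\<in>S. d e s * G i s)"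
    using assms(4) by metis
  obtain c where c: "\<exists>t\<in>T. c t \<noteq> 0" "\<forall>s\<in>S. (\<Sum>t\<in>T. c t * d t s) = 0"
    using homogeneous_system_nontrivial[of S T "\<lambda>s t. d t s"] assms \<open>\<not> card T \<le> card S\<close>
    by fastforce
  have "(\<Sum>t\<in>T. c t * G i t) = 0" if "i \<in> I" for i
  proof -
    have "(\<Sum>t\<in>T. c t * G i t) = (\<Sum>t\<in>T. \<Sum>s\<in>S. c t * d t s * G i s)"
    proof (rule sum.cong[OF refl])
      fix t assume "t \<in> T"
      then have "G i t = (\<Sum>s\<in>S. d t s * G i s)" using d that by blast
      then have "c t * G i t = c t * (\<Sum>s\<in>S. d t s * G i s)" by (rule arg_cong)
      then show "c t * G i t = (\<Sum>s\<in>S. c t * d t s * G i s)"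
        by (simp add: sum_distrib_left mult.assoc)
    qed
    also have "\<dots> = (\<Sum>s\<in>S. (\<Sum>t\<in>T. c t * d t s) * G i s)"
      by (subst sum.swap) (simp add: sum_distrib_right)
    finally show ?thesis using c(2) by simp
  qed
  then show False using assms(1) c(1) unfolding column_matroid_def by blast
qed

text \<open>Replaces the maximum over all independent subsets by the size of any one spanning
  independent subset.\<close>

lemma matroid_rank_eq_card:
  assumes "finite B" "S \<subseteq> B" "column_matroid I G S"
    and "\<forall>e\<in>B. \<exists>d. \<forall>i\<in>I. G i e = (\<Sum>s\<in>S. d s * G i s)"
  shows "matroid_rank (column_matroid I G) B = card S"
  unfolding matroid_rank_def
proof (rule Max_eqI)
  show "finite (card ` {S. S \<subseteq> B \<and> column_matroid I G S})" using assms(1) by simp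
  show "card S \<in> card ` {S. S \<subseteq> B \<and> column_matroid I G S}" using assms by blast
  fix y assume "y \<in> card ` {S. S \<subseteq> B \<and> column_matroid I G S}"
  then obtain T where "T \<subseteq> B" "column_matroid I G T" "y = card T" by blast
  with assms show "y \<le> card S"
    using card_independent_le_spanning[of I G T S] finite_subset[of T B] finite_subset[of S B]
    by blast
qed

subsection \<open>Flows vanishing on a set of columns\<close>

text \<open>Common frame of the two cases. The ring acts on the group through \<open>scale\<close>,
  and \<open>\<phi>\<close> embeds it into the field over which linear dependence is taken: the
  integers into the rationals, or a finite field into itself. The kind of matrix enters through
  \<open>integral\<close>.\<close>

locale integral_columns = Modules.module scale + inj_comm_ring_hom \<phi>
  for scale :: "'r::comm_ring_1 \<Rightarrow> 'a::{ab_group_add,finite} \<Rightarrow> 'a"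
    and \<phi> :: "'r \<Rightarrow> 'k::field" +
  fixes I :: "'i set" and E :: "'e set" and M :: "'i \<Rightarrow> 'e \<Rightarrow> 'r"
  assumes finite_E: "finite E"
    and integral: "\<And>S e d s. S \<subseteq> E \<Longrightarrow> column_matroid I (\<lambda>i e. \<phi> (M i e)) S \<Longrightarrow> e \<in> E \<Longrightarrow>
      \<forall>i\<in>I. \<phi> (M i e) = (\<Sum>s\<in>S. d s * \<phi> (M i s)) \<Longrightarrow> s \<in> S \<Longrightarrow> d s \<in> range \<phi>"
begin

definition indep :: "'e set \<Rightarrow> bool" where
  "indep = column_matroid I (\<lambda>i e. \<phi> (M i e))"

definition orth :: "('e \<Rightarrow> 'r) \<Rightarrow> bool" where
  "orth v \<longleftrightarrow> (\<forall>i\<in>I. (\<Sum>e\<in>E. \<phi> (M i e) * \<phi> (v e)) = 0)"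

text \<open>For the two instances of the locale this unfolds to \<open>group_flow\<close> and
  \<open>field_flow\<close>.\<close>

definition flow :: "('e \<Rightarrow> 'a) \<Rightarrow> bool" where
  "flow h \<longleftrightarrow> (\<forall>n (H :: nat \<Rightarrow> 'e \<Rightarrow> 'r).
     orthogonally_dual I {..<n} E (\<lambda>i e. \<phi> (M i e)) (\<lambda>j e. \<phi> (H j e)) \<longrightarrow>
       (\<forall>j<n. (\<Sum>e\<in>E. scale (H j e) (h e)) = 0))"

text \<open>\<open>D\<close> is the reduced form of the matrix relative to the column basis
  \<open>S\<close>: column \<open>e\<close> of \<open>D\<close> holds the ring coordinates of column
  \<open>e\<close> of \<open>M\<close>, and \<open>D\<close> is the identity on
  \<open>S\<close>.\<close>

definition coords :: "'e set \<Rightarrow> ('e \<Rightarrow> 'e \<Rightarrow> 'r) \<Rightarrow> bool" where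
  "coords S D \<longleftrightarrow> S \<subseteq> E \<and> indep S \<and>
     (\<forall>e\<in>E. \<forall>i\<in>I. \<phi> (M i e) = (\<Sum>s\<in>S. \<phi> (D s e) * \<phi> (M i s))) \<and>
     (\<forall>s\<in>S. \<forall>e\<in>S. D s e = (if s = e then 1 else 0))"

lemma coords_finite: "coords S D \<Longrightarrow> finite S"
  using finite_E finite_subset unfolding coords_def by blast

text \<open>A basis \<open>SB\<close> of \<open>B\<close> is extended to a basis \<open>S\<close> of
  \<open>E\<close>; \<open>integral\<close> places the coordinates in the ring. That columns of
  \<open>B\<close> have no coordinates outside \<open>SB\<close> is what makes the flows vanishing
  on \<open>B\<close> easy to count.\<close>

lemma coords_exist:
  assumes "B \<subseteq> E"
  obtains SB S D where "SB \<subseteq> B" "SB \<subseteq> S" "coords S D"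
    "\<And>e s. e \<in> B \<Longrightarrow> s \<in> S - SB \<Longrightarrow> D s e = 0"
    "matroid_rank indep B = card SB" "matroid_rank indep E = card S"
proof -
  let ?G = "\<lambda>i e. \<phi> (M i e)"
  have "column_matroid I ?G {}" by (simp add: column_matroid_def)
  then obtain SB where SB: "SB \<subseteq> B" "column_matroid I ?G SB"
    "\<forall>e\<in>B. \<exists>d. \<forall>i\<in>I. ?G i e = (\<Sum>s\<in>SB. d s * ?G i s)"
    using column_basis_extend[of I ?G "{}" B] finite_subset[OF assms finite_E] by auto
  obtain S where S: "SB \<subseteq> S" "S \<subseteq> E" "column_matroid I ?G S"
    "\<forall>e\<in>E. \<exists>d. \<forall>i\<in>I. ?G i e = (\<Sum>s\<in>S. d s * ?G i s)"
    using column_basis_extend[of I ?G SB E] SB assms finite_E by blast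
  have fin: "finite S" using S(2) finite_E finite_subset by blast
  have "\<exists>D. \<forall>i\<in>I. ?G i e = (\<Sum>s\<in>S. \<phi> (D s) * ?G i s)" if e: "e \<in> E" for e
  proof -
    obtain d where d: "\<forall>i\<in>I. ?G i e = (\<Sum>s\<in>S. d s * ?G i s)" using S(4) e by blast
    then have "\<forall>s\<in>S. \<exists>x. \<phi> x = d s"
      using integral[OF S(2,3) e d] by (metis imageE)
    then obtain D where "\<forall>s\<in>S. \<phi> (D s) = d s" by metis
    then have "(\<Sum>s\<in>S. \<phi> (D s) * ?G i s) = (\<Sum>s\<in>S. d s * ?G i s)" for i
      by (intro sum.cong) auto
    with d show ?thesis by metis
  qed
  then obtain D' where D': "\<forall>e\<in>E. \<forall>i\<in>I. ?G i e = (\<Sum>s\<in>S. \<phi> (D' e s) * ?G i s)" by metis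
  define D where "D = (\<lambda>s e. D' e s)"
  have D: "?G i e = (\<Sum>s\<in>S. \<phi> (D s e) * ?G i s)" if "e \<in> E" "i \<in> I" for e i
    using D' that unfolding D_def by blast
  have "D s e = (if s = e then 1 else 0)" if "s \<in> S" "e \<in> S" for s e
  proof -
    have "?G i e = (\<Sum>x\<in>S. (if x = e then 1 else 0) * ?G i x)" for i
      using fin that by (simp add: sum_delta_mult)
    then have "\<forall>i\<in>I. (\<Sum>x\<in>S. \<phi> (D x e) * ?G i x) = (\<Sum>x\<in>S. (if x = e then 1 else 0) * ?G i x)"
      using D[of e] that S(2) by (metis subsetD)
    from column_matroid_unique_coeffs[OF S(3) this that(1)]
    show ?thesis by (auto split: if_splits)
  qed
  then have c: "coords S D"
    using S D unfolding coords_def indep_def by blast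
  \<comment> \<open>The expansion of a column of \<open>B\<close> in \<open>SB\<close>, padded with
    zeros, is its expansion in \<open>S\<close> by uniqueness.\<close>
  have z: "D s e = 0" if e: "e \<in> B" and s: "s \<in> S - SB" for s e
  proof -
    obtain d where d: "\<forall>i\<in>I. ?G i e = (\<Sum>s\<in>SB. d s * ?G i s)" using SB(3) e by blast
    have "(\<Sum>x\<in>S. (if x \<in> SB then d x else 0) * ?G i x) = (\<Sum>s\<in>SB. d s * ?G i s)" for i
      using fin S(1) by (intro sum.mono_neutral_cong_right) auto
    then have "\<forall>i\<in>I. (\<Sum>x\<in>S. \<phi> (D x e) * ?G i x) = (\<Sum>x\<in>S. (if x \<in> SB then d x else 0) * ?G i x)"
      using D[of e] d e assms by (metis subsetD)
    from column_matroid_unique_coeffs[OF S(3) this, of s] s show ?thesis by simp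
  qed
  have "matroid_rank indep B = card SB" "matroid_rank indep E = card S"
    unfolding indep_def using SB S assms finite_E
    by (intro matroid_rank_eq_card; blast intro: finite_subset)+
  with that[OF SB(1) S(1) c z] show thesis by blast
qed

text \<open>Substituting the expansions of the columns into the orthogonality relation gives a
  relation among the independent columns \<open>S\<close>, so its coefficients vanish; injectivity
  of \<open>\<phi>\<close> carries this back to the ring.\<close>

lemma orth_coeff:
  assumes "coords S D" "orth v" "s \<in> S"
  shows "(\<Sum>e\<in>E. v e * D s e) = 0"
proof -
  let ?c = "\<lambda>s. \<phi> (\<Sum>e\<in>E. v e * D s e)"
  have "(\<Sum>s\<in>S. ?c s * \<phi> (M i s)) = 0" if i: "i \<in> I" for i
  proof -
    have "(\<Sum>s\<in>S. ?c s * \<phi> (M i s)) = (\<Sum>s\<in>S. \<Sum>e\<in>E. \<phi> (v e) * (\<phi> (D s e) * \<phi> (M i s)))"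
      by (simp add: hom_sum hom_mult sum_distrib_right mult.assoc)
    also have "\<dots> = (\<Sum>e\<in>E. \<phi> (v e) * (\<Sum>s\<in>S. \<phi> (D s e) * \<phi> (M i s)))"
      by (subst sum.swap) (simp add: sum_distrib_left)
    also have "\<dots> = (\<Sum>e\<in>E. \<phi> (M i e) * \<phi> (v e))"
      using assms(1) i unfolding coords_def by (intro sum.cong) (metis mult.commute)+
    finally show ?thesis using assms(2) i unfolding orth_def by simp
  qed
  then have "\<forall>s\<in>S. ?c s = 0"
    using assms(1)[unfolded coords_def indep_def column_matroid_def,
        THEN conjunct2, THEN conjunct1, rule_format, of ?c] by blast
  with assms(3) show ?thesis by simp
qed

text \<open>The analogue of a fundamental circuit: the linear relation that expresses column
  \<open>e\<close> through the basis \<open>S\<close>, read as a vector over the ring.\<close>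

definition fundamental :: "'e set \<Rightarrow> ('e \<Rightarrow> 'e \<Rightarrow> 'r) \<Rightarrow> 'e \<Rightarrow> 'e \<Rightarrow> 'r" where
  "fundamental S D e x = (if x = e then 1 else 0) - (if x \<in> S then D x e else 0)"

lemma orth_fundamental:
  assumes "coords S D" "e \<in> E"
  shows "orth (fundamental S D e)"
  unfolding orth_def
proof
  fix i assume i: "i \<in> I"
  have "(\<Sum>x\<in>E. \<phi> (M i x) * \<phi> (fundamental S D e x)) =
    (\<Sum>x\<in>E. (if x = e then \<phi> (M i x) else 0)) - (\<Sum>x\<in>E. (if x \<in> S then \<phi> (D x e) * \<phi> (M i x) else 0))"
    unfolding fundamental_def sum_subtractf[symmetric]
    by (intro sum.cong) (auto simp: hom_minus algebra_simps)
  also have "(\<Sum>x\<in>E. (if x = e then \<phi> (M i x) else 0)) = \<phi> (M i e)"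
    using assms(2) finite_E by simp
  also have "(\<Sum>x\<in>E. (if x \<in> S then \<phi> (D x e) * \<phi> (M i x) else 0)) = (\<Sum>x\<in>S. \<phi> (D x e) * \<phi> (M i x))"
    using assms(1) finite_E unfolding coords_def by (intro sum.mono_neutral_cong_right) auto
  also have "\<dots> = \<phi> (M i e)"
    using assms i unfolding coords_def by metis
  finally show "(\<Sum>x\<in>E. \<phi> (M i x) * \<phi> (fundamental S D e x)) = 0" by simp
qed

lemma sum_fundamental:
  assumes "coords S D" "e \<in> E"
  shows "(\<Sum>x\<in>E. scale (fundamental S D e x) (h x)) = h e - (\<Sum>s\<in>S. scale (D s e) (h s))"
proof -
  have "(\<Sum>x\<in>E. scale (fundamental S D e x) (h x)) =
    (\<Sum>x\<in>E. if x = e then h x else 0) - (\<Sum>x\<in>E. if x \<in> S then scale (D x e) (h x) else 0)"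
    unfolding fundamental_def sum_subtractf[symmetric]
    by (intro sum.cong) (auto simp: scale_left_diff_distrib)
  also have "(\<Sum>x\<in>E. if x \<in> S then scale (D x e) (h x) else 0) = (\<Sum>s\<in>S. scale (D s e) (h s))"
    using assms(1) finite_E unfolding coords_def by (intro sum.mono_neutral_cong_right) auto
  finally show ?thesis using assms(2) finite_E by simp
qed

text \<open>
  Any integral vector orthogonal to \<open>M\<close> occurs as a row of some orthogonally dual matrix: append
  it to the fundamental vectors of a basis.
\<close>

lemma flow_iff_orth: "flow h \<longleftrightarrow> (\<forall>v. orth v \<longrightarrow> (\<Sum>e\<in>E. scale (v e) (h e)) = 0)"
proof
  assume *: "\<forall>v. orth v \<longrightarrow> (\<Sum>e\<in>E. scale (v e) (h e)) = 0"
  show "flow h"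
    unfolding flow_def
  proof (intro allI impI)
    fix n j and H :: "nat \<Rightarrow> 'e \<Rightarrow> 'r"
    assume "orthogonally_dual I {..<n} E (\<lambda>i e. \<phi> (M i e)) (\<lambda>j e. \<phi> (H j e))" "j < n"
    then have "orth (H j)" by (simp add: orthogonally_dual_def orth_def)
    with * show "(\<Sum>e\<in>E. scale (H j e) (h e)) = 0" by blast
  qed
next
  assume flow: "flow h"
  show "\<forall>v. orth v \<longrightarrow> (\<Sum>e\<in>E. scale (v e) (h e)) = 0"
  proof (intro allI impI)
    fix v assume v: "orth v"
    obtain S D where c: "coords S D" and r: "matroid_rank indep E = card S"
      by (rule coords_exist[OF subset_refl])
    have SE: "S \<subseteq> E" using c by (simp add: coords_def)
    define m where "m = card (E - S)"
    obtain f where f: "bij_betw f {..<m} (E - S)"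
      using ex_bij_betw_nat_finite[of "E - S"] finite_E by (auto simp: m_def atLeast0LessThan)
    define H where "H = (\<lambda>j. if j < m then fundamental S D (f j) else v)"
    have H: "orth (H j)" for j
      using orth_fundamental[OF c] v f by (auto simp: H_def bij_betw_def)
    let ?H = "\<lambda>j e. \<phi> (H j e)"
    \<comment> \<open>The rank of \<open>H\<close> is found by showing that its columns outside
      \<open>S\<close> form a basis. They are independent because, restricted to these columns, the
      first \<open>m\<close> rows are the unit vectors.\<close>
    have "column_matroid {..<Suc m} ?H (E - S)"
      unfolding column_matroid_def
    proof (intro allI impI ballI)
      fix d e assume d: "\<forall>i\<in>{..<Suc m}. (\<Sum>e\<in>E - S. d e * ?H i e) = 0" and e: "e \<in> E - S"
      from e f have "e \<in> f ` {..<m}" by (simp add: bij_betw_def)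
      then obtain j where j: "j < m" "f j = e" by auto
      have "(\<Sum>x\<in>E - S. d x * ?H j x) = (\<Sum>x\<in>E - S. if x = e then d x else 0)"
        using j by (intro sum.cong) (auto simp: H_def fundamental_def)
      also have "\<dots> = d e" using e finite_E by simp
      finally show "d e = 0" using d j by simp
    qed
    moreover have "\<exists>d. \<forall>j\<in>{..<Suc m}. ?H j e = (\<Sum>x\<in>E - S. d x * ?H j x)" if e: "e \<in> E" for e
    proof (cases "e \<in> S")
      case False
      then show ?thesis
        using e finite_E by (intro exI[of _ "\<lambda>x. if x = e then 1 else 0"]) (simp add: sum_delta_mult)
    next
      case True
      \<comment> \<open>Every row of \<open>H\<close> is orthogonal to \<open>M\<close>, so
        \<open>orth_coeff\<close> expresses its entry at a basis element \<open>e\<close> through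
        its entries outside \<open>S\<close>, with coefficients that do not depend on the
        row.\<close>
      have "?H j e = (\<Sum>x\<in>E - S. - \<phi> (D e x) * ?H j x)" for j
      proof -
        have "(\<Sum>x\<in>E. H j x * D e x) = (\<Sum>x\<in>S. H j x * D e x) + (\<Sum>x\<in>E - S. H j x * D e x)"
          using SE finite_E by (metis sum.subset_diff add.commute)
        also have "(\<Sum>x\<in>S. H j x * D e x) = (\<Sum>x\<in>S. if x = e then H j x else 0)"
          using c True unfolding coords_def by (intro sum.cong) auto
        also have "\<dots> = H j e" using True coords_finite[OF c] by simp
        finally have "H j e = - (\<Sum>x\<in>E - S. H j x * D e x)"
          using orth_coeff[OF c H[of j] True] by (simp add: eq_neg_iff_add_eq_0)
        then have "?H j e = \<phi> (- (\<Sum>x\<in>E - S. H j x * D e x))" by (rule arg_cong)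
        then show ?thesis
          by (simp add: hom_uminus hom_sum hom_mult sum_negf mult.commute)
      qed
      then show ?thesis by (intro exI[of _ "\<lambda>x. - \<phi> (D e x)"] ballI)
    qed
    ultimately have "mat_rank {..<Suc m} E ?H = m"
      unfolding mat_rank_def m_def
      by (intro matroid_rank_eq_card) (use finite_E in auto)
    moreover have "card S + m = card E"
      unfolding m_def using SE finite_E
      by (simp add: card_Diff_subset finite_subset card_mono)
    ultimately have "orthogonally_dual I {..<Suc m} E (\<lambda>i e. \<phi> (M i e)) ?H"
      using r H unfolding orthogonally_dual_def mat_rank_def indep_def orth_def by simp
    then have "(\<Sum>e\<in>E. scale (H m e) (h e)) = 0"
      using flow unfolding flow_def by blast
    then show "(\<Sum>e\<in>E. scale (v e) (h e)) = 0" by (simp add: H_def)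
  qed
qed

text \<open>Orthogonality to the fundamental vectors is exactly this system of equations;
  conversely, after substituting them, \<open>orth_coeff\<close> annihilates the sum for every
  orthogonal \<open>v\<close>. So flows are the combinations of the rows of
  \<open>D\<close>.\<close>

lemma flow_iff_coords:
  assumes c: "coords S D"
  shows "flow h \<longleftrightarrow> (\<forall>e\<in>E. h e = (\<Sum>s\<in>S. scale (D s e) (h s)))"
proof
  assume "flow h"
  show "\<forall>e\<in>E. h e = (\<Sum>s\<in>S. scale (D s e) (h s))"
  proof
    fix e assume e: "e \<in> E"
    then have "(\<Sum>x\<in>E. scale (fundamental S D e x) (h x)) = 0"
      using \<open>flow h\<close> orth_fundamental[OF c] unfolding flow_iff_orth by blast
    then show "h e = (\<Sum>s\<in>S. scale (D s e) (h s))"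
      using sum_fundamental[OF c e, of h] by simp
  qed
next
  assume h: "\<forall>e\<in>E. h e = (\<Sum>s\<in>S. scale (D s e) (h s))"
  show "flow h"
    unfolding flow_iff_orth
  proof (intro allI impI)
    fix v assume v: "orth v"
    have "(\<Sum>e\<in>E. scale (v e) (h e)) = (\<Sum>e\<in>E. scale (v e) (\<Sum>s\<in>S. scale (D s e) (h s)))"
      by (intro sum.cong refl arg_cong[of _ _ "scale _"]) (use h in blast)
    also have "\<dots> = (\<Sum>e\<in>E. \<Sum>s\<in>S. scale (v e * D s e) (h s))"
      by (simp add: scale_sum_right)
    also have "\<dots> = (\<Sum>s\<in>S. scale (\<Sum>e\<in>E. v e * D s e) (h s))"
      by (subst sum.swap) (simp add: scale_sum_left)
    also have "\<dots> = 0" using orth_coeff[OF c v] by simp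
    finally show "(\<Sum>e\<in>E. scale (v e) (h e)) = 0" .
  qed
qed

text \<open>Restriction to \<open>S - SB\<close> is a bijection: a flow vanishing on
  \<open>B\<close> is zero on \<open>SB\<close>, its values on \<open>S - SB\<close> are free, and
  they determine the flow on all of \<open>E\<close>.\<close>

lemma card_flows_vanishing:
  assumes "B \<subseteq> E"
  shows "card {h \<in> E \<rightarrow>\<^sub>E UNIV. flow h \<and> (\<forall>e\<in>B. h e = 0)} =
    CARD('a) ^ (matroid_rank indep E - matroid_rank indep B)"
proof -
  obtain SB S D where SB: "SB \<subseteq> B" "SB \<subseteq> S" and c: "coords S D"
    and z: "\<And>e s. e \<in> B \<Longrightarrow> s \<in> S - SB \<Longrightarrow> D s e = 0"
    and r: "matroid_rank indep B = card SB" "matroid_rank indep E = card S"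
    using coords_exist[OF assms] by metis
  have SE: "S \<subseteq> E" and delta: "\<And>s e. s \<in> S \<Longrightarrow> e \<in> S \<Longrightarrow> D s e = (if s = e then 1 else 0)"
    using c by (auto simp: coords_def)
  have fin: "finite S" using coords_finite[OF c] .
  let ?T = "S - SB"
  let ?F = "{h \<in> E \<rightarrow>\<^sub>E UNIV. flow h \<and> (\<forall>e\<in>B. h e = 0)}"
  \<comment> \<open>The inverse map: values on \<open>?T\<close> are continued by zero on
    \<open>SB\<close> and then along the coordinates to all of \<open>E\<close>.\<close>
  let ?ext = "\<lambda>g. \<lambda>e\<in>E. (\<Sum>s\<in>?T. scale (D s e) (g s))"
  have ext: "?ext g s = g s" if "s \<in> ?T" for g s
  proof -
    have "?ext g s = (\<Sum>x\<in>?T. if x = s then g x else 0)"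
      using that SE delta by (auto intro!: sum.cong)
    with that fin show ?thesis by simp
  qed
  have ext0: "?ext g e = 0" if "e \<in> B" for g e
    using that z assms by auto
  have "bij_betw (\<lambda>h. restrict h ?T) ?F (?T \<rightarrow>\<^sub>E UNIV)"
  proof (rule bij_betwI[where g = ?ext])
    show "(\<lambda>h. restrict h ?T) \<in> ?F \<rightarrow> (?T \<rightarrow>\<^sub>E UNIV)" by auto
    show "?ext \<in> (?T \<rightarrow>\<^sub>E UNIV) \<rightarrow> ?F"
    proof
      fix g :: "'e \<Rightarrow> 'a"
      have "flow (?ext g)"
        unfolding flow_iff_coords[OF c]
      proof
        fix e assume e: "e \<in> E"
        have "(\<Sum>s\<in>S. scale (D s e) (?ext g s)) = (\<Sum>s\<in>?T. scale (D s e) (g s))"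
        proof (rule sum.mono_neutral_cong_right)
          show "\<forall>s\<in>S - ?T. scale (D s e) (?ext g s) = 0"
            using ext0 SB by (auto simp del: restrict_apply)
          show "\<And>s. s \<in> ?T \<Longrightarrow> scale (D s e) (?ext g s) = scale (D s e) (g s)"
            by (simp only: ext)
        qed (use fin in auto)
        with e show "?ext g e = (\<Sum>s\<in>S. scale (D s e) (?ext g s))" by simp
      qed
      then show "?ext g \<in> ?F"
        by (intro CollectI conjI ballI ext0) auto
    qed
    show "?ext (restrict h ?T) = h" if h: "h \<in> ?F" for h
    proof
      fix e
      show "?ext (restrict h ?T) e = h e"
      proof (cases "e \<in> E")
        case True
        have "(\<Sum>s\<in>?T. scale (D s e) (restrict h ?T s)) = (\<Sum>s\<in>S. scale (D s e) (h s))"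
          using h SB fin by (intro sum.mono_neutral_cong_left) auto
        also have "\<dots> = h e" using h True flow_iff_coords[OF c, of h] by simp
        finally show ?thesis using True by simp
      next
        case False
        with h show ?thesis by (auto simp: PiE_def extensional_def)
      qed
    qed
    show "restrict (?ext g) ?T = g" if g: "g \<in> ?T \<rightarrow>\<^sub>E UNIV" for g
    proof
      fix s
      show "restrict (?ext g) ?T s = g s"
        using ext[of s g] g by (cases "s \<in> ?T") (auto simp: PiE_def extensional_def)
    qed
  qed
  then have "card ?F = card (?T \<rightarrow>\<^sub>E (UNIV :: 'a set))" by (rule bij_betw_same_card)
  also have "\<dots> = CARD('a) ^ (card S - card SB)"
    using fin SB(2) by (simp add: card_funcsetE card_Diff_subset finite_subset)
  finally show ?thesis using r by simp
qed

end

subsection \<open>The support enumerator of the flows\<close>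

context integral_columns
begin

lemma flow_cong: "(\<And>e. e \<in> E \<Longrightarrow> h e = h' e) \<Longrightarrow> flow h = flow h'"
  unfolding flow_iff_orth by simp

text \<open>These bounds ensure that no subtraction in the exponents is truncated.\<close>

lemma rank_le:
  assumes "B \<subseteq> E"
  shows "matroid_rank indep B \<le> card B" "matroid_rank indep B \<le> matroid_rank indep E"
    "matroid_rank indep E \<le> card E"
proof -
  obtain SB S D where *: "SB \<subseteq> B" "SB \<subseteq> S" "coords S D"
    "matroid_rank indep B = card SB" "matroid_rank indep E = card S"
    using coords_exist[OF assms] by metis
  then have "S \<subseteq> E" by (simp add: coords_def)
  with * assms finite_E show "matroid_rank indep B \<le> card B"
    "matroid_rank indep B \<le> matroid_rank indep E" "matroid_rank indep E \<le> card E"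
    by (auto intro!: card_mono intro: finite_subset)
qed

lemma sum_flows_support:
  fixes \<omega> :: complex
  assumes "\<omega> \<noteq> 0" "\<omega> \<noteq> 1"
  defines "r \<equiv> matroid_rank indep E"
  shows "(\<Sum>h\<in>{h \<in> E \<rightarrow>\<^sub>E UNIV. flow h}. \<omega> ^ card (supp E h)) =
    \<omega> ^ (card E - r) * (1 - \<omega>) ^ r *
      rank_gen_poly E indep (of_nat CARD('a) * \<omega> / (1 - \<omega>)) ((1 - \<omega>) / \<omega>)"
proof -
  let ?F = "{h \<in> E \<rightarrow>\<^sub>E UNIV. flow h}"
  let ?q = "of_nat CARD('a) :: complex"
  have "finite (E \<rightarrow>\<^sub>E (UNIV :: 'a set))" using finite_E by (intro finite_PiE) auto
  then have finF: "finite ?F" by simp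
  have expand: "\<omega> ^ card (supp E h) =
    (\<Sum>X\<in>Pow E. (1 - \<omega>) ^ card X * \<omega> ^ (card E - card X) * of_bool (\<forall>e\<in>X. h e = 0))" for h :: "'e \<Rightarrow> 'a"
  proof -
    have "\<omega> ^ card (supp E h) = (\<Prod>e\<in>E. if h e \<noteq> 0 then \<omega> else 1)"
      using finite_E by (simp add: supp_def prod.If_cases Int_def)
    also have "\<dots> = (\<Prod>e\<in>E. (1 - \<omega>) * of_bool (h e = 0) + \<omega>)"
      by (intro prod.cong) auto
    also have "\<dots> = (\<Sum>X\<in>Pow E. (\<Prod>e\<in>X. (1 - \<omega>) * of_bool (h e = 0)) * (\<Prod>e\<in>E - X. \<omega>))"
      using finite_E by (rule prod_add)
    also have "\<dots> = (\<Sum>X\<in>Pow E. (1 - \<omega>) ^ card X * \<omega> ^ (card E - card X) * of_bool (\<forall>e\<in>X. h e = 0))"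
    proof (intro sum.cong refl)
      fix X assume "X \<in> Pow E"
      then have X: "X \<subseteq> E" "finite X" using finite_E finite_subset by auto
      have "(\<Prod>e\<in>X. of_bool (h e = 0)) = (of_bool (\<forall>e\<in>X. h e = 0) :: complex)"
        using X(2) by (induction X rule: finite_induct) auto
      with X show "(\<Prod>e\<in>X. (1 - \<omega>) * of_bool (h e = 0)) * (\<Prod>e\<in>E - X. \<omega>) =
        (1 - \<omega>) ^ card X * \<omega> ^ (card E - card X) * of_bool (\<forall>e\<in>X. h e = 0)"
        by (simp add: prod.distrib card_Diff_subset mult_ac)
    qed
    finally show ?thesis .
  qed
  have "(\<Sum>h\<in>?F. \<omega> ^ card (supp E h)) =
    (\<Sum>X\<in>Pow E. \<Sum>h\<in>?F. (1 - \<omega>) ^ card X * \<omega> ^ (card E - card X) * of_bool (\<forall>e\<in>X. h e = 0))"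
    unfolding expand by (rule sum.swap)
  also have "\<dots> = (\<Sum>X\<in>Pow E. \<omega> ^ (card E - r) * (1 - \<omega>) ^ r *
    ((?q * \<omega> / (1 - \<omega>)) ^ (r - matroid_rank indep X) *
     ((1 - \<omega>) / \<omega>) ^ (card X - matroid_rank indep X)))"
  proof (intro sum.cong refl)
    fix X assume "X \<in> Pow E"
    then have X: "X \<subseteq> E" by simp
    define \<rho> where "\<rho> = matroid_rank indep X"
    have le: "\<rho> \<le> card X" "\<rho> \<le> r" "r \<le> card E" "card X \<le> card E"
      using rank_le[OF X] card_mono[OF finite_E X] by (simp_all add: \<rho>_def r_def)
    have "(\<Sum>h\<in>?F. of_bool (\<forall>e\<in>X. h e = 0)) = (of_nat (card {h \<in> ?F. \<forall>e\<in>X. h e = 0}) :: complex)"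
      using finF by (simp add: sum_of_bool_eq Int_def)
    also have "{h \<in> ?F. \<forall>e\<in>X. h e = 0} = {h \<in> E \<rightarrow>\<^sub>E UNIV. flow h \<and> (\<forall>e\<in>X. h e = 0)}"
      by auto
    also have "of_nat (card \<dots>) = ?q ^ (r - \<rho>)"
      using card_flows_vanishing[OF X] by (simp add: r_def \<rho>_def)
    finally have cnt: "(\<Sum>h\<in>?F. of_bool (\<forall>e\<in>X. h e = 0)) = ?q ^ (r - \<rho>)" .
    \<comment> \<open>Both sides have exponent \<open>card E - \<rho>\<close>. Together with
      \<open>e2\<close> this matches the summands once the denominators of the rank generating
      polynomial are cleared.\<close>
    have e1: "\<omega> ^ (card E - card X) * \<omega> ^ (card X - \<rho>) = \<omega> ^ (card E - r) * \<omega> ^ (r - \<rho>)"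
      using le by (simp flip: power_add)
    have e2: "(1 - \<omega>) ^ card X * (1 - \<omega>) ^ (r - \<rho>) = (1 - \<omega>) ^ r * (1 - \<omega>) ^ (card X - \<rho>)"
      using le by (simp add: add.commute flip: power_add)
    have "(1 - \<omega>) ^ card X * \<omega> ^ (card E - card X) * ?q ^ (r - \<rho>) *
        (\<omega> ^ (card X - \<rho>) * (1 - \<omega>) ^ (r - \<rho>)) =
      (\<omega> ^ (card E - card X) * \<omega> ^ (card X - \<rho>)) * ((1 - \<omega>) ^ card X * (1 - \<omega>) ^ (r - \<rho>)) * ?q ^ (r - \<rho>)"
      by (simp add: mult_ac)
    also have "\<dots> = \<omega> ^ (card E - r) * (1 - \<omega>) ^ r * (?q ^ (r - \<rho>) * \<omega> ^ (r - \<rho>) * (1 - \<omega>) ^ (card X - \<rho>))"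
      unfolding e1 e2 by (simp add: mult_ac)
    finally have "(1 - \<omega>) ^ card X * \<omega> ^ (card E - card X) * ?q ^ (r - \<rho>) =
      \<omega> ^ (card E - r) * (1 - \<omega>) ^ r * (?q ^ (r - \<rho>) * \<omega> ^ (r - \<rho>) * (1 - \<omega>) ^ (card X - \<rho>)) /
        (\<omega> ^ (card X - \<rho>) * (1 - \<omega>) ^ (r - \<rho>))"
      using assms by (subst eq_divide_eq) auto
    then show "(\<Sum>h\<in>?F. (1 - \<omega>) ^ card X * \<omega> ^ (card E - card X) * of_bool (\<forall>e\<in>X. h e = 0)) =
      \<omega> ^ (card E - r) * (1 - \<omega>) ^ r *
        ((?q * \<omega> / (1 - \<omega>)) ^ (r - matroid_rank indep X) *
         ((1 - \<omega>) / \<omega>) ^ (card X - matroid_rank indep X))"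
      by (simp add: cnt power_divide power_mult_distrib mult_ac flip: sum_distrib_left \<rho>_def)
  qed
  finally show ?thesis
    by (simp add: rank_gen_poly_def sum_distrib_left r_def)
qed

end

text \<open>As \<open>\<omega> ^ \<sigma> = 1\<close>, the factor \<open>\<omega> ^ k\<close> equals
  \<open>\<omega>\<close> to the support size on the whole residue class, and the classes partition
  all pairs. Sending \<open>(f, g)\<close> to \<open>(f - g, g)\<close> then splits off a free
  choice of \<open>g\<close>.\<close>

lemma sum_flow_pairs:
  fixes \<omega> :: complex and flow :: "('e \<Rightarrow> 'a::{ab_group_add,finite}) \<Rightarrow> bool"
  assumes "finite E" "\<sigma> > 0" "\<omega> ^ \<sigma> = 1"
    and cong: "\<And>h h'. (\<And>e. e \<in> E \<Longrightarrow> h e = h' e) \<Longrightarrow> flow h = flow h'"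
  shows "(\<Sum>k = 0..\<sigma> - 1. \<omega> ^ k * of_nat (card (flow_pairs E flow k \<sigma>))) =
    of_nat CARD('a) ^ card E * (\<Sum>h\<in>{h \<in> E \<rightarrow>\<^sub>E UNIV. flow h}. \<omega> ^ card (supp E h))"
proof -
  let ?U = "E \<rightarrow>\<^sub>E (UNIV :: 'a set)"
  let ?F = "{h \<in> ?U. flow h}"
  define P where "P = {p \<in> ?U \<times> ?U. flow (\<lambda>e. fst p e - snd p e)}"
  define w where "w p = card (supp E (\<lambda>e. fst p e - snd p e))" for p :: "('e \<Rightarrow> 'a) \<times> ('e \<Rightarrow> 'a)"
  have finU: "finite ?U" using assms by (intro finite_PiE) auto
  then have finP: "finite P" by (simp add: P_def)
  have "(\<Sum>k = 0..\<sigma> - 1. \<omega> ^ k * of_nat (card (flow_pairs E flow k \<sigma>))) =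
    (\<Sum>k = 0..\<sigma> - 1. \<Sum>p\<in>{p \<in> P. w p mod \<sigma> = k}. \<omega> ^ w p)"
  proof (intro sum.cong refl)
    fix k assume "k \<in> {0..\<sigma> - 1}"
    then have k: "k mod \<sigma> = k" using assms(2) by auto
    have eq: "flow_pairs E flow k \<sigma> = {p \<in> P. w p mod \<sigma> = k}"
      by (auto simp: flow_pairs_def P_def w_def cong_def k)
    have pow: "\<omega> ^ n = \<omega> ^ (n mod \<sigma>)" for n
      using assms(3) by (metis div_mult_mod_eq mult.commute mult_1 power_add power_mult power_one)
    have "(\<Sum>p\<in>{p \<in> P. w p mod \<sigma> = k}. \<omega> ^ w p) = (\<Sum>p\<in>{p \<in> P. w p mod \<sigma> = k}. \<omega> ^ k)"
    proof (intro sum.cong refl)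
      fix p assume "p \<in> {p \<in> P. w p mod \<sigma> = k}"
      then show "\<omega> ^ w p = \<omega> ^ k" using pow[of "w p"] by simp
    qed
    then show "\<omega> ^ k * of_nat (card (flow_pairs E flow k \<sigma>)) = (\<Sum>p\<in>{p \<in> P. w p mod \<sigma> = k}. \<omega> ^ w p)"
      by (simp add: eq)
  qed
  also have "\<dots> = (\<Sum>p\<in>P. \<omega> ^ w p)"
  proof (rule sum.group[OF finP])
    have "w p mod \<sigma> \<le> \<sigma> - 1" for p
      using mod_less_divisor[OF assms(2), of "w p"] by simp
    then show "(\<lambda>p. w p mod \<sigma>) ` P \<subseteq> {0..\<sigma> - 1}" by auto
  qed simp
  also have "\<dots> = (\<Sum>(h, g)\<in>?F \<times> ?U. \<omega> ^ card (supp E h))"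
  \<comment> \<open>Both maps restrict to \<open>E\<close>, because the functions counted are
    \<open>undefined\<close> elsewhere; the hypothesis \<open>cong\<close> makes the flow condition
    insensitive to this.\<close>
  proof (rule sum.reindex_bij_witness[where
        i = "\<lambda>(h, g). (\<lambda>e\<in>E. h e + g e, g)" and j = "\<lambda>(f, g). (\<lambda>e\<in>E. f e - g e, g)"])
    fix p assume "p \<in> P"
    then show "(case case p of (f, g) \<Rightarrow> (\<lambda>e\<in>E. f e - g e, g) of (h, g) \<Rightarrow> (\<lambda>e\<in>E. h e + g e, g)) = p"
      by (cases p) (auto simp: P_def fun_eq_iff PiE_def extensional_def)
    show "(case p of (f, g) \<Rightarrow> (\<lambda>e\<in>E. f e - g e, g)) \<in> ?F \<times> ?U"
    proof (cases p)
      case (Pair f g)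
      with \<open>p \<in> P\<close> have "flow (\<lambda>e. f e - g e)" "g \<in> ?U" by (auto simp: P_def)
      moreover have "flow (\<lambda>e\<in>E. f e - g e) = flow (\<lambda>e. f e - g e)" by (rule cong) simp
      ultimately show ?thesis using Pair by simp
    qed
    show "(case case p of (f, g) \<Rightarrow> (\<lambda>e\<in>E. f e - g e, g) of (h, g) \<Rightarrow> \<omega> ^ card (supp E h)) = \<omega> ^ w p"
      by (cases p) (auto simp: w_def supp_def intro!: arg_cong[of _ _ "\<lambda>A. \<omega> ^ card A"])
  next
    fix b assume b: "b \<in> ?F \<times> ?U"
    then show "(case case b of (h, g) \<Rightarrow> (\<lambda>e\<in>E. h e + g e, g) of (f, g) \<Rightarrow> (\<lambda>e\<in>E. f e - g e, g)) = b"
      by (cases b) (auto simp: fun_eq_iff PiE_def extensional_def)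
    show "(case b of (h, g) \<Rightarrow> (\<lambda>e\<in>E. h e + g e, g)) \<in> P"
    proof (cases b)
      case (Pair h g)
      have "flow (\<lambda>e. (\<lambda>e\<in>E. h e + g e) e - g e) = flow h" by (rule cong) simp
      with b Pair show ?thesis by (simp add: P_def)
    qed
  qed
  also have "\<dots> = (\<Sum>h\<in>?F. \<Sum>g\<in>?U. \<omega> ^ card (supp E h))"
    by (rule sum.cartesian_product[symmetric])
  also have "\<dots> = of_nat CARD('a) ^ card E * (\<Sum>h\<in>?F. \<omega> ^ card (supp E h))"
    using assms(1) by (simp add: card_funcsetE sum_distrib_left)
  finally show ?thesis .
qed

theorem (in integral_columns) sum_flow_pairs_rank_gen_poly:
  fixes \<omega> :: complex
  assumes "\<sigma> > 1" "primitive_root_of_unity \<sigma> \<omega>"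
  defines "r \<equiv> matroid_rank indep E"
  shows "(\<Sum>k = 0..\<sigma> - 1. \<omega> ^ k * of_nat (card (flow_pairs E flow k \<sigma>))) =
    \<omega> ^ (card E - r) * (1 - \<omega>) ^ r * of_nat CARD('a) ^ card E *
      rank_gen_poly E indep (of_nat CARD('a) * \<omega> / (1 - \<omega>)) ((1 - \<omega>) / \<omega>)"
proof -
  \<comment> \<open>Primitivity at exponent 1, which is below \<open>\<sigma>\<close>, excludes
    \<open>\<omega> = 1\<close>; with \<open>\<omega> \<noteq> 0\<close> this makes the arguments of
    the polynomial meaningful.\<close>
  have w: "\<omega> ^ \<sigma> = 1" "\<omega> \<noteq> 1"
    using assms(1,2)
    by (auto simp: primitive_root_of_unity_def dest: spec[of _ 1])
  then have "\<omega> \<noteq> 0" using assms(1) by (auto simp: power_0_left)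
  with w show ?thesis
    using sum_flow_pairs[of E \<sigma> \<omega> flow, OF finite_E _ w(1) flow_cong] sum_flows_support[of \<omega>] assms(1)
    by (simp add: r_def mult_ac)
qed


subsection \<open>Integrality of the coefficients\<close>

text \<open>Suitable rows \<open>R\<close> cut out of the columns \<open>S\<close> a nonsingular
  square matrix, of determinant 1 or -1; its integral adjugate solves for the coefficients.\<close>

lemma totally_unimodular_integral:
  assumes TU: "totally_unimodular I E G" and fin: "finite I" "finite E"
    and S: "S \<subseteq> E" "column_matroid I (rat_mat G) S" and e: "e \<in> E"
    and d: "\<forall>i\<in>I. rat_mat G i e = (\<Sum>s\<in>S. d s * rat_mat G i s)" and s: "s \<in> S"
  shows "d s \<in> \<int>"
proof -
  let ?Q = "rat_mat G"
  have finS: "finite S" using S(1) fin(2) finite_subset by blast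
  \<comment> \<open>The basis lemma applied to the transpose: \<open>R\<close> is a row basis of the
    submatrix with columns \<open>S\<close>.\<close>
  obtain R where R: "R \<subseteq> I" "column_matroid S (\<lambda>s i. ?Q i s) R"
    "\<forall>i\<in>I. \<exists>c. \<forall>s\<in>S. ?Q i s = (\<Sum>r\<in>R. c r * ?Q r s)"
    by (rule column_basis_extend[of S "\<lambda>s i. ?Q i s" "{}" I])
      (use fin in \<open>auto simp: column_matroid_def\<close>)
  have finR: "finite R" using R(1) fin(1) finite_subset by blast
  \<comment> \<open>A relation of the columns \<open>S\<close> that holds on the rows
    \<open>R\<close> holds on all rows, so it is trivial.\<close>
  have zero: "\<forall>s\<in>S. c s = 0" if c: "\<forall>r\<in>R. (\<Sum>s\<in>S. c s * ?Q r s) = 0" for c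
  proof -
    have "(\<Sum>s\<in>S. c s * ?Q i s) = 0" if i: "i \<in> I" for i
    proof -
      obtain b where b: "\<forall>s\<in>S. ?Q i s = (\<Sum>r\<in>R. b r * ?Q r s)" using R(3) i by blast
      have "(\<Sum>s\<in>S. c s * ?Q i s) = (\<Sum>s\<in>S. c s * (\<Sum>r\<in>R. b r * ?Q r s))"
        by (intro sum.cong refl arg_cong[of _ _ "(*) _"]) (use b in blast)
      also have "\<dots> = (\<Sum>s\<in>S. \<Sum>r\<in>R. b r * (c s * ?Q r s))"
        by (simp add: sum_distrib_left mult_ac)
      also have "\<dots> = (\<Sum>r\<in>R. b r * (\<Sum>s\<in>S. c s * ?Q r s))"
        by (subst sum.swap) (simp add: sum_distrib_left)
      finally show ?thesis using c by simp
    qed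
    then show ?thesis using S(2) unfolding column_matroid_def by blast
  qed
  \<comment> \<open>Row rank equals column rank: either strict inequality would leave a homogeneous
    system with more unknowns than equations.\<close>
  have "card R = card S"
  proof (rule antisym; rule ccontr)
    assume "\<not> card R \<le> card S"
    then obtain c where "\<exists>r\<in>R. c r \<noteq> 0" "\<forall>s\<in>S. (\<Sum>r\<in>R. c r * ?Q r s) = 0"
      using homogeneous_system_nontrivial[of S R "\<lambda>s r. ?Q r s"] finS finR by auto
    with R(2) show False unfolding column_matroid_def by blast
  next
    assume "\<not> card S \<le> card R"
    then obtain c where "\<exists>s\<in>S. c s \<noteq> 0" "\<forall>r\<in>R. (\<Sum>s\<in>S. c s * ?Q r s) = 0"
      using homogeneous_system_nontrivial[of R S "\<lambda>r s. ?Q r s"] finS finR by auto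
    with zero show False by blast
  qed
  define n where "n = card S"
  obtain a where a: "bij_betw a {..<n} R"
    using ex_bij_betw_nat_finite[OF finR] \<open>card R = card S\<close> by (auto simp: n_def atLeast0LessThan)
  obtain b where b: "bij_betw b {..<n} S"
    using ex_bij_betw_nat_finite[OF finS] by (auto simp: n_def atLeast0LessThan)
  define A where "A = mat n n (\<lambda>(i, j). G (a i) (b j))"
  have A: "A \<in> carrier_mat n n" by (simp add: A_def)
  have aI: "a i \<in> I" "a i \<in> R" if "i < n" for i
    using a R(1) that by (auto simp: bij_betw_def)
  have reindex: "(\<Sum>s\<in>S. g s) = (\<Sum>j<n. g (b j))" for g :: "_ \<Rightarrow> rat"
    using sum.reindex_bij_betw[OF b, of g] by simp
  have "det A \<noteq> 0"
  proof
    assume "det A = 0"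
    \<comment> \<open>The integers being a domain, a singular matrix has a nonzero integer kernel
      vector; transported along \<open>b\<close> it contradicts \<open>zero\<close>.\<close>
    then obtain v where v: "v \<in> carrier_vec n" "v \<noteq> 0\<^sub>v n" "A *\<^sub>v v = 0\<^sub>v n"
      unfolding det_0_iff_vec_prod_zero[OF A] by blast
    define c where "c s = (of_int (v $ (the_inv_into {..<n} b s)) :: rat)" for s
    have cb: "c (b j) = of_int (v $ j)" if "j < n" for j
      using b that by (simp add: c_def the_inv_into_f_f bij_betw_def)
    have "(\<Sum>s\<in>S. c s * ?Q r s) = 0" if "r \<in> R" for r
    proof -
      have "r \<in> a ` {..<n}" using that a by (simp add: bij_betw_def)
      then obtain i where i: "i < n" "r = a i" by auto
      have "(\<Sum>s\<in>S. c s * ?Q r s) = (\<Sum>j<n. of_int (G (a i) (b j) * v $ j))"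
        unfolding reindex by (intro sum.cong) (auto simp: cb i rat_mat_def)
      also have "\<dots> = of_int ((A *\<^sub>v v) $ i)"
        using i v(1) by (simp add: A_def scalar_prod_def atLeast0LessThan)
      finally show ?thesis using v(3) i by simp
    qed
    then have "\<forall>s\<in>S. c s = 0" using zero by blast
    then have "v $ j = 0" if "j < n" for j
      using cb[OF that] that b by (auto simp: bij_betw_def)
    with v(1,2) show False by (auto simp: vec_eq_iff)
  qed
  moreover have "det A \<in> {-1, 0, 1}"
    using TU a b R(1) S(1) unfolding totally_unimodular_def A_def bij_betw_def by blast
  ultimately have detA: "of_int (det A) * (of_int (det A) :: rat) = 1" by auto
  obtain j where j: "j < n" "s = b j"
    using s b by (auto simp: bij_betw_def)
  let ?J = "adj_mat A"
  have J: "?J \<in> carrier_mat n n" using adj_mat(1)[OF A] .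
  have prod: "(\<Sum>k<n. ?J $$ (j, k) * G (a k) (b l)) = (if j = l then det A else 0)" if l: "l < n" for l
  proof -
    have "(\<Sum>k<n. ?J $$ (j, k) * G (a k) (b l)) = (?J * A) $$ (j, l)"
      using j l J A by (simp add: scalar_prod_def A_def atLeast0LessThan)
    also have "\<dots> = (if j = l then det A else 0)"
      using adj_mat(3)[OF A] j l by simp
    finally show ?thesis .
  qed
  \<comment> \<open>Combining the equations of the rows \<open>a k\<close> with row \<open>j\<close>
    of the adjugate isolates \<open>d s\<close> times the determinant, while the left-hand side is
    an integer.\<close>
  have "of_int (\<Sum>k<n. ?J $$ (j, k) * G (a k) e) = (\<Sum>k<n. of_int (?J $$ (j, k)) * ?Q (a k) e)"
    by (simp add: rat_mat_def)
  also have "\<dots> = (\<Sum>k<n. of_int (?J $$ (j, k)) * (\<Sum>l<n. d (b l) * ?Q (a k) (b l)))"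
    by (intro sum.cong refl arg_cong[of _ _ "(*) _"]) (use d aI in \<open>simp add: reindex\<close>)
  also have "\<dots> = (\<Sum>k<n. \<Sum>l<n. d (b l) * of_int (?J $$ (j, k) * G (a k) (b l)))"
    by (simp add: sum_distrib_left rat_mat_def mult_ac)
  also have "\<dots> = (\<Sum>l<n. d (b l) * of_int (\<Sum>k<n. ?J $$ (j, k) * G (a k) (b l)))"
    by (subst sum.swap) (simp add: sum_distrib_left)
  also have "\<dots> = (\<Sum>l<n. if l = j then d (b l) * of_int (det A) else 0)"
    by (intro sum.cong) (auto simp: prod)
  also have "\<dots> = d s * of_int (det A)" using j by simp
  finally have "d s * of_int (det A) \<in> \<int>" by (metis Ints_of_int)
  \<comment> \<open>A second factor \<open>det A\<close> cancels the first, since its square is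
    1.\<close>
  then have "d s * of_int (det A) * of_int (det A) \<in> \<int>" by (rule Ints_mult) (rule Ints_of_int)
  moreover have "d s * of_int (det A) * of_int (det A) = d s"
    using detA by (metis mult.assoc mult.right_neutral)
  ultimately show ?thesis by metis
qed

text \<open>
  The columns with non-integral coefficients are edges of a forest without leaves: at a leaf, the
  row of the matrix would isolate a single coefficient.
\<close>

lemma vertex_edge_integral:
  fixes I :: "'v set" and E :: "'e set"
  assumes VE: "vertex_edge_matrix I E G" and fin: "finite E"
    and S: "S \<subseteq> E" "column_matroid I (rat_mat G) S" and e: "e \<in> E"
    and d: "\<forall>i\<in>I. rat_mat G i e = (\<Sum>s\<in>S. d s * rat_mat G i s)" and s: "s \<in> S"
  shows "d s \<in> \<int>"
proof (rule ccontr)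
  assume "d s \<notin> \<int>"
  let ?Q = "rat_mat G"
  obtain D :: "('v, 'e) pre_digraph" where D: "fin_digraph D" "verts D = I" "arcs D = E"
    and G: "\<And>v x. v \<in> I \<Longrightarrow> x \<in> E \<Longrightarrow>
      G v x = (if head D x = v then 1 else 0) - (if tail D x = v then 1 else 0)"
    using VE unfolding vertex_edge_matrix_def by blast
  interpret fin_digraph D by (rule D(1))
  have ends: "head D x \<in> I" "tail D x \<in> I" if "x \<in> E" for x
    using that D by auto
  define S' where "S' = {s \<in> S. d s \<notin> \<int>}"
  have S': "s \<in> S'" "S' \<subseteq> S" "S' \<subseteq> E" using \<open>d s \<notin> \<int>\<close> s S(1) by (auto simp: S'_def)
  have finS: "finite S" "finite S'" using S(1) S'(3) fin finite_subset by blast+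
  have ind: "column_matroid I ?Q S'" using column_matroid_subset[OF S(2) S'(2) finS(1)] .
  \<comment> \<open>The full combination is an integer entry of \<open>G\<close>, and so is the part
    with integral coefficients; hence the remainder over \<open>S'\<close> is integral at every
    vertex.\<close>
  have int: "(\<Sum>x\<in>S'. d x * ?Q v x) \<in> \<int>" if v: "v \<in> I" for v
  proof -
    have "(\<Sum>x\<in>S'. d x * ?Q v x) = ?Q v e - (\<Sum>x\<in>S - S'. d x * ?Q v x)"
      using d v sum.subset_diff[OF S'(2) finS(1), of "\<lambda>x. d x * ?Q v x"] by simp
    moreover have "(\<Sum>x\<in>S - S'. d x * ?Q v x) \<in> \<int>"
      by (intro Ints_sum Ints_mult) (auto simp: S'_def rat_mat_def)
    ultimately show ?thesis by (simp add: rat_mat_def)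
  qed
  \<comment> \<open>A loop has a zero column, which is dependent.\<close>
  have noloop: "head D x \<noteq> tail D x" if x: "x \<in> S'" for x
  proof
    assume loop: "head D x = tail D x"
    let ?c = "\<lambda>y. if y = x then 1 else 0 :: rat"
    have "(\<Sum>y\<in>S'. ?c y * ?Q v y) = ?Q v x" for v
      using sum_delta_mult[OF finS(2) x] .
    moreover have "?Q v x = 0" if "v \<in> I" for v
      using G[OF that, of x] loop x S'(3) by (auto simp: rat_mat_def)
    ultimately have "\<forall>y\<in>S'. ?c y = 0"
      using ind[unfolded column_matroid_def, rule_format, of ?c] by auto
    with x show False by auto
  qed
  define V where "V = head D ` S' \<union> tail D ` S'"
  have V: "finite V" "V \<subseteq> I" "V \<noteq> {}"
    using finS(2) ends S' by (auto simp: V_def)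
  let ?inc = "\<lambda>v x. v = head D x \<or> v = tail D x"
  have deg: "2 \<le> card {x \<in> S'. ?inc v x}" if v: "v \<in> V" for v
  proof (rule ccontr)
    assume "\<not> 2 \<le> card {x \<in> S'. ?inc v x}"
    moreover have "card {x \<in> S'. ?inc v x} \<noteq> 0"
      using v finS(2) by (auto simp: V_def)
    ultimately have "card {x \<in> S'. ?inc v x} = 1" by simp
    then obtain y where y: "{x \<in> S'. ?inc v x} = {y}" by (rule card_1_singletonE)
    then have yS: "y \<in> S'" "?inc v y" by blast+
    have vI: "v \<in> I" using v V(2) by blast
    have "(\<Sum>x\<in>S'. d x * ?Q v x) = (\<Sum>x\<in>{y}. d x * ?Q v x)"
    proof (rule sum.mono_neutral_right)
      show "\<forall>x\<in>S' - {y}. d x * ?Q v x = 0"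
      proof
        fix x assume x: "x \<in> S' - {y}"
        then have "\<not> ?inc v x" using y by blast
        then have "G v x = 0" using G[OF vI, of x] x S'(3) by auto
        then show "d x * ?Q v x = 0" by (simp add: rat_mat_def)
      qed
    qed (use finS(2) yS in auto)
    moreover have "G v y = 1 \<or> G v y = - 1"
      using G[OF vI, of y] yS S'(3) noloop[OF yS(1)] by auto
    ultimately have "d y \<in> \<int>"
      using int[OF vI] by (auto simp: rat_mat_def)
    with yS(1) show False by (simp add: S'_def)
  qed
  \<comment> \<open>Double counting of incidences: each edge of \<open>S'\<close> meets exactly two
    vertices of \<open>V\<close> and each vertex at least two edges, so
    \<open>card V \<le> card S'\<close>.\<close>
  have "{v \<in> V. ?inc v x} = {head D x, tail D x}" if "x \<in> S'" for x
    using that by (auto simp: V_def)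
  then have "\<forall>x\<in>S'. card {v \<in> V. ?inc v x} = 2"
    using noloop by simp
  then have "(\<Sum>v\<in>V. card {x \<in> S'. ?inc v x}) = 2 * card S'"
    using sum_multicount[OF V(1) finS(2), of ?inc 2] by simp
  moreover have "(\<Sum>v\<in>V. 2) \<le> (\<Sum>v\<in>V. card {x \<in> S'. ?inc v x})"
    by (rule sum_mono) (rule deg)
  ultimately have cardV: "card V \<le> card S'" by simp
  obtain v0 where v0: "v0 \<in> V" using V(3) by blast
  \<comment> \<open>Leaving out the equation at one vertex makes the system underdetermined, which
    yields a nontrivial relation on the other rows of \<open>V\<close>.\<close>
  have "card (V - {v0}) < card S'"
    using card_Diff1_less[OF V(1) v0] cardV by simp
  then obtain c where c: "\<exists>x\<in>S'. c x \<noteq> 0" "\<forall>v\<in>V - {v0}. (\<Sum>x\<in>S'. c x * ?Q v x) = 0"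
    using homogeneous_system_nontrivial[of "V - {v0}" S' ?Q] V(1) finS(2) by auto
  \<comment> \<open>Head and tail contributions cancel in each column, so the omitted equation at
    \<open>v0\<close> follows from the others. The relation then holds at every vertex and
    contradicts independence.\<close>
  have col: "(\<Sum>v\<in>V. ?Q v x) = 0" if x: "x \<in> S'" for x
  proof -
    have "(\<Sum>v\<in>V. ?Q v x) = (\<Sum>v\<in>V. (if head D x = v then 1 else 0) - (if tail D x = v then 1 else 0))"
    proof (intro sum.cong refl)
      fix v assume "v \<in> V"
      then show "?Q v x = (if head D x = v then 1 else 0) - (if tail D x = v then 1 else 0)"
        using G[of v x] subsetD[OF V(2)] subsetD[OF S'(3) x] by (simp add: rat_mat_def)
    qed
    also have "\<dots> = 0"
      using x V(1) by (simp add: sum_subtractf V_def)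
    finally show ?thesis .
  qed
  have "(\<Sum>v\<in>V. \<Sum>x\<in>S'. c x * ?Q v x) = (\<Sum>x\<in>S'. c x * (\<Sum>v\<in>V. ?Q v x))"
    by (subst sum.swap) (simp add: sum_distrib_left)
  also have "\<dots> = 0" using col by simp
  finally have "(\<Sum>x\<in>S'. c x * ?Q v0 x) = 0"
    using sum.remove[OF V(1) v0, of "\<lambda>v. \<Sum>x\<in>S'. c x * ?Q v x"] c(2) by simp
  then have inV: "(\<Sum>x\<in>S'. c x * ?Q v x) = 0" if "v \<in> V" for v
    using c(2) that by (cases "v = v0") auto
  have "(\<Sum>x\<in>S'. c x * ?Q v x) = 0" if v: "v \<in> I" for v
  proof (cases "v \<in> V")
    case False
    have "?Q v x = 0" if x: "x \<in> S'" for x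
    proof -
      have "head D x \<noteq> v" "tail D x \<noteq> v" using False x by (auto simp: V_def)
      then show ?thesis using G[OF v subsetD[OF S'(3) x]] by (simp add: rat_mat_def)
    qed
    then show ?thesis by simp
  qed (rule inV)
  then show False using ind c(1) unfolding column_matroid_def by blast
qed

subsection \<open>Cycle-edge matrices\<close>

definition signed_value :: "('e \<Rightarrow> rat) \<Rightarrow> 'e \<times> bool \<Rightarrow> rat" where
  "signed_value w s = (if snd s then w (fst s) else - w (fst s))"

definition potential_on :: "('v, 'e) pre_digraph \<Rightarrow> 'e set \<Rightarrow> ('v \<Rightarrow> rat) \<Rightarrow> ('e \<Rightarrow> rat) \<Rightarrow> bool" where
  "potential_on D F \<pi> w \<longleftrightarrow> (\<forall>e\<in>F. w e = \<pi> (head D e) - \<pi> (tail D e))"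

lemma signed_value_potential:
  assumes "potential_on D F \<pi> w" "fst s \<in> F"
  shows "signed_value w s = \<pi> (step_to D s) - \<pi> (step_from D s)"
  using assms by (auto simp: potential_on_def signed_value_def step_to_def step_from_def)

text \<open>Distinctness of the edges keeps \<open>(e, True)\<close> and \<open>(e, False)\<close>
  from both occurring, so the product with a matrix row splits into one signed term per
  step.\<close>

lemma sum_cycle_vector:
  assumes "distinct (map fst c)" "fst ` set c \<subseteq> E" "finite E"
  shows "(\<Sum>e\<in>E. w e * of_int (cycle_vector c e)) = (\<Sum>s\<leftarrow>c. signed_value w s)"
  using assms
proof (induction c)
  case Nil
  then show ?case by (simp add: cycle_vector_def)
next
  case (Cons s c)
  have "w e * of_int (cycle_vector (s # c) e) =
    (if e = fst s then signed_value w s else 0) + w e * of_int (cycle_vector c e)" for e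
    using Cons.prems(1) by (cases s) (force simp: cycle_vector_def signed_value_def)
  then have "(\<Sum>e\<in>E. w e * of_int (cycle_vector (s # c) e)) =
    (\<Sum>e\<in>E. if e = fst s then signed_value w s else 0) + (\<Sum>e\<in>E. w e * of_int (cycle_vector c e))"
    by (simp only: sum.distrib)
  with Cons show ?case by simp
qed

lemma sum_cyclic_shift:
  fixes f :: "nat \<Rightarrow> 'a::comm_monoid_add"
  assumes "n > 0"
  shows "(\<Sum>i<n. f (Suc i mod n)) = (\<Sum>i<n. f i)"
proof -
  obtain m where n: "n = Suc m" using assms gr0_implies_Suc by blast
  have "(\<Sum>i<m. f (Suc i mod Suc m)) = (\<Sum>i<m. f (Suc i))"
    by (intro sum.cong) auto
  then have "(\<Sum>i<n. f (Suc i mod n)) = (\<Sum>i<m. f (Suc i)) + f 0"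
    unfolding n sum.lessThan_Suc by simp
  also have "\<dots> = (\<Sum>i<n. f i)"
    unfolding n sum.lessThan_Suc_shift by (rule add.commute)
  finally show ?thesis .
qed

text \<open>The sum telescopes around the closed walk: every step ends where its cyclic successor
  starts.\<close>

lemma sum_cycle_potential:
  assumes c: "is_cycle D c" and pot: "potential_on D (fst ` set c) \<pi> w"
  shows "(\<Sum>s\<leftarrow>c. signed_value w s) = 0"
proof -
  let ?n = "length c"
  have n: "?n > 0" using c by (simp add: is_cycle_def)
  have "(\<Sum>s\<leftarrow>c. signed_value w s) = (\<Sum>i<?n. signed_value w (c ! i))"
    by (simp add: sum_list_sum_nth atLeast0LessThan)
  also have "\<dots> = (\<Sum>i<?n. \<pi> (step_from D (c ! (Suc i mod ?n))) - \<pi> (step_from D (c ! i)))"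
  proof (intro sum.cong refl)
    fix i assume i: "i \<in> {..<?n}"
    then have "step_to D (c ! i) = step_from D (c ! (Suc i mod ?n))"
      using c by (simp add: is_cycle_def)
    then show "signed_value w (c ! i) =
      \<pi> (step_from D (c ! (Suc i mod ?n))) - \<pi> (step_from D (c ! i))"
      using signed_value_potential[OF pot, of "c ! i"] i by simp
  qed
  also have "\<dots> = 0"
    using sum_cyclic_shift[OF n, of "\<lambda>i. \<pi> (step_from D (c ! i))"] by (simp add: sum_subtractf)
  finally show ?thesis .
qed

text \<open>Partial sums along the cycle serve as potential. They are well defined because the
  starting vertices are distinct, and they close up because the total is zero. The conclusion
  mentions only the edge set, hence no longer the traversal.\<close>

lemma cycle_potential:
  assumes c: "is_cycle D c" and zero: "(\<Sum>s\<leftarrow>c. signed_value w s) = 0"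
  shows "\<exists>\<pi>. potential_on D (fst ` set c) \<pi> w"
proof -
  let ?n = "length c" and ?from = "\<lambda>i. step_from D (c ! i)"
  define p where "p i = (\<Sum>j<i. signed_value w (c ! j))" for i
  define \<pi> where "\<pi> v = p (the_inv_into {..<?n} ?from v)" for v
  have inj: "inj_on ?from {..<?n}"
  proof (rule inj_onI)
    fix i j assume "i \<in> {..<?n}" "j \<in> {..<?n}" "?from i = ?from j"
    then show "i = j"
      using c nth_eq_iff_index_eq[of "map (step_from D) c" i j] by (simp add: is_cycle_def)
  qed
  have from_val: "\<pi> (?from i) = p i" if "i < ?n" for i
    using the_inv_into_f_f[OF inj, of i] that by (simp add: \<pi>_def)
  have "p ?n = 0"
    using zero by (simp add: p_def sum_list_sum_nth atLeast0LessThan)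
  have to_val: "\<pi> (step_to D (c ! i)) = p (Suc i)" if i: "i < ?n" for i
  proof -
    have "step_to D (c ! i) = ?from (Suc i mod ?n)" "Suc i mod ?n < ?n"
      using c i by (auto simp: is_cycle_def intro: mod_less_divisor)
    then have "\<pi> (step_to D (c ! i)) = p (Suc i mod ?n)" using from_val by simp
    moreover have "p (Suc i mod ?n) = p (Suc i)"
    \<comment> \<open>At the last step the index wraps around to 0, where both \<open>p 0\<close>
      and \<open>p ?n\<close> are zero.\<close>
    proof (cases "Suc i = ?n")
      case True
      then have "Suc i mod ?n = 0" by simp
      moreover have "p (Suc i) = 0" using True \<open>p ?n = 0\<close> by simp
      ultimately show ?thesis by (simp add: p_def)
    next
      case False
      with i have "Suc i < ?n" by simp
      then show ?thesis by simp
    qed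
    ultimately show ?thesis by simp
  qed
  have "w e = \<pi> (head D e) - \<pi> (tail D e)" if e: "e \<in> fst ` set c" for e
  proof -
    obtain i where i: "i < ?n" "e = fst (c ! i)" using e by (auto simp: in_set_conv_nth)
    have "\<pi> (step_to D (c ! i)) - \<pi> (?from i) = signed_value w (c ! i)"
      unfolding to_val[OF i(1)] from_val[OF i(1)] by (simp add: p_def)
    then show ?thesis
      by (auto simp: i(2) signed_value_def step_to_def step_from_def split: if_splits)
  qed
  then show ?thesis unfolding potential_on_def by blast
qed

section \<open>Simple paths in the underlying undirected multigraph and existence of
  potentials\<close>

inductive simple_path :: "('v, 'e) pre_digraph \<Rightarrow> 'e set \<Rightarrow> 'v \<Rightarrow> ('e \<times> bool) list \<Rightarrow> 'v \<Rightarrow> bool"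
  for D F where
  Nil: "simple_path D F v [] v"
| Cons: "fst s \<in> F \<Longrightarrow> simple_path D F (step_to D s) p v \<Longrightarrow>
    step_from D s \<notin> insert v (step_from D ` set p) \<Longrightarrow> simple_path D F (step_from D s) (s # p) v"

definition step_rel :: "('v, 'e) pre_digraph \<Rightarrow> 'e set \<Rightarrow> ('v \<times> 'v) set" where
  "step_rel D F = {(step_from D s, step_to D s) | s. fst s \<in> F}"

lemma simple_path_suffix:
  assumes "simple_path D F u p v" "x \<in> insert v (step_from D ` set p)"
  shows "\<exists>p'. simple_path D F x p' v"
  using assms
proof (induction rule: simple_path.induct)
  case (Nil v)
  then have "x = v" by simp
  then show ?case by (auto intro: simple_path.Nil)
next
  case (Cons s p v)
  show ?case
  proof (cases "x = step_from D s")
    case True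
    then show ?thesis using simple_path.Cons[OF Cons.hyps(1,2,3)] by blast
  next
    case False
    then show ?thesis using Cons by auto
  qed
qed

text \<open>When a new first step starts at a vertex already on the path, the path is cut down to
  its suffix from that vertex instead of being extended.\<close>

lemma simple_path_exists:
  assumes "(u, v) \<in> (step_rel D F)\<^sup>*"
  shows "\<exists>p. simple_path D F u p v"
  using assms
proof (induction rule: converse_rtrancl_induct)
  case base
  show ?case by (intro exI) (rule simple_path.Nil)
next
  case (step u x)
  then obtain p s where p: "simple_path D F x p v"
    and s: "fst s \<in> F" "u = step_from D s" "x = step_to D s"
    by (auto simp: step_rel_def)
  show ?case
  proof (cases "u \<in> insert v (step_from D ` set p)")
    case True
    with p show ?thesis by (rule simple_path_suffix)
  next
    case False
    with p s show ?thesis using simple_path.Cons[of s F D p v] by auto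
  qed
qed

lemma simple_path_start:
  "simple_path D F u p v \<Longrightarrow> u = (if p = [] then v else step_from D (p ! 0))"
  by (erule simple_path.cases) auto

lemma simple_path_distinct:
  assumes "simple_path D F u p v"
  shows "fst ` set p \<subseteq> F" "distinct (map (step_from D) p)" "v \<notin> step_from D ` set p"
    "step_to D ` set p \<subseteq> insert v (step_from D ` set p)" "distinct (map fst p)"
  using assms
proof (induction rule: simple_path.induct)
  case (Cons s p v)
  {
    case 1 then show ?case using Cons by auto
  next
    case 2 then show ?case using Cons by auto
  next
    case 3 then show ?case using Cons by auto
  next
    case 4 then show ?case
      using Cons simple_path_start[OF Cons.hyps(2)] by (cases p) auto
  next
    case 5
    have "fst s \<noteq> fst t" if t: "t \<in> set p" for t
    proof
      assume "fst s = fst t"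
      \<comment> \<open>A repeated edge would bring the path back to its first vertex, as both ends
        of a later step are later vertices of the path.\<close>
      then have "step_from D s \<in> {step_from D t, step_to D t}"
        by (auto simp: step_from_def step_to_def)
      then show False using Cons t by auto
    qed
    then show ?case using Cons by auto
  }
qed auto

lemma simple_path_chain:
  assumes "simple_path D F u p v" "i < length p"
  shows "step_to D (p ! i) = (if Suc i < length p then step_from D (p ! Suc i) else v)"
  using assms
proof (induction arbitrary: i rule: simple_path.induct)
  case (Cons s p v)
  then show ?case
    using simple_path_start[OF Cons.hyps(2)] by (cases i) auto
qed simp

lemma sum_simple_path_potential:
  assumes "simple_path D F u p v" "potential_on D F \<pi> w"
  shows "(\<Sum>s\<leftarrow>p. signed_value w s) = \<pi> v - \<pi> u"
  using assms by (induction rule: simple_path.induct) (auto simp: signed_value_potential)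

lemma simple_path_closes_cycle:
  assumes p: "simple_path D F (step_to D s) p (step_from D s)" and F: "fst s \<notin> F" "insert (fst s) F \<subseteq> arcs D"
  shows "is_cycle D (s # p)"
proof -
  note * = simple_path_distinct[OF p]
  have "step_to D ((s # p) ! i) = step_from D ((s # p) ! (Suc i mod length (s # p)))"
    if i: "i < length (s # p)" for i
  proof (cases i)
    case 0
    then show ?thesis using simple_path_start[OF p] by (cases p) auto
  next
    case (Suc j)
    then have j: "j < length p" using i by simp
    show ?thesis
    proof (cases "Suc j < length p")
      case True
      then show ?thesis using simple_path_chain[OF p j] Suc by simp
    next
      case False
      \<comment> \<open>The last step of \<open>p\<close> is followed cyclically by
        \<open>s\<close>, at index 0.\<close>
      then have "Suc i = length (s # p)" using Suc j by simp
      then have "Suc i mod length (s # p) = 0" by simp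
      then show ?thesis using simple_path_chain[OF p j] Suc False by simp
    qed
  qed
  moreover have "distinct (map fst (s # p))" "distinct (map (step_from D) (s # p))"
    "fst ` set (s # p) \<subseteq> arcs D"
    using * F by auto
  ultimately show ?thesis unfolding is_cycle_def by blast
qed

text \<open>Edges are added one at a time. If the ends of the new edge are already connected, a path
  between them closes a cycle, which forces the right value; otherwise the potential can be shifted
  by a constant on one component.\<close>

lemma potential_exists:
  assumes "finite F" "F \<subseteq> arcs D"
    and "\<And>c. is_cycle D c \<Longrightarrow> fst ` set c \<subseteq> F \<Longrightarrow> (\<Sum>s\<leftarrow>c. signed_value w s) = 0"
  shows "\<exists>\<pi>. potential_on D F \<pi> w"
  using assms
proof (induction F rule: finite_induct)
  case empty
  then show ?case by (simp add: potential_on_def)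
next
  case (insert e F)
  have "\<exists>\<pi>. potential_on D F \<pi> w"
    using insert.prems by (intro insert.IH) (auto dest: subset_insertI2)
  then obtain \<pi> where \<pi>: "potential_on D F \<pi> w" by blast
  let ?a = "tail D e" and ?b = "head D e" and ?R = "step_rel D F"
  show ?case
  proof (cases "(?b, ?a) \<in> ?R\<^sup>*")
    case True
    then obtain p where p: "simple_path D F ?b p ?a" using simple_path_exists[OF True] by blast
    let ?s = "(e, True)"
    have "is_cycle D (?s # p)"
      using p insert.hyps insert.prems(1)
      by (intro simple_path_closes_cycle[of D F]) (auto simp: step_to_def step_from_def)
    moreover have "fst ` set (?s # p) \<subseteq> insert e F"
      using simple_path_distinct(1)[OF p] by auto
    ultimately have "(\<Sum>s\<leftarrow>?s # p. signed_value w s) = 0" by (rule insert.prems(2))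
    then have "w e = \<pi> ?b - \<pi> ?a"
      using sum_simple_path_potential[OF p \<pi>] by (simp add: signed_value_def)
    with \<pi> show ?thesis by (auto simp: potential_on_def)
  next
    case False
    \<comment> \<open>\<open>\<delta>\<close> is the error of the old potential at the new edge; it
      is corrected by raising the component of the head of \<open>e\<close>, which does not contain
      the tail.\<close>
    define \<delta> where "\<delta> = w e - (\<pi> ?b - \<pi> ?a)"
    define \<pi>' where "\<pi>' v = (if (?b, v) \<in> ?R\<^sup>* then \<pi> v + \<delta> else \<pi> v)" for v
    have "w f = \<pi>' (head D f) - \<pi>' (tail D f)" if f: "f \<in> F" for f
    proof -
      have "(tail D f, head D f) \<in> ?R"
        unfolding step_rel_def using f
        by (intro CollectI exI[of _ "(f, True)"]) (simp add: step_from_def step_to_def)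
      moreover have "(head D f, tail D f) \<in> ?R"
        unfolding step_rel_def using f
        by (intro CollectI exI[of _ "(f, False)"]) (simp add: step_from_def step_to_def)
      \<comment> \<open>Steps may be taken in both directions, so the ends of an old edge lie in the
        same component and their difference is unchanged.\<close>
      ultimately have "(?b, head D f) \<in> ?R\<^sup>* \<longleftrightarrow> (?b, tail D f) \<in> ?R\<^sup>*"
        by (meson rtrancl.rtrancl_into_rtrancl)
      then show ?thesis using \<pi> f by (auto simp: \<pi>'_def potential_on_def)
    qed
    moreover have "w e = \<pi>' ?b - \<pi>' ?a" using False by (simp add: \<pi>'_def \<delta>_def)
    ultimately show ?thesis by (auto simp: potential_on_def)
  qed
qed

text \<open>
  The coefficients of a column give a vector orthogonal to all cycles, hence a potential difference.
  Its difference with that of the rounded potential is orthogonal to all cycles as well and is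
  supported on the independent columns, so it vanishes.
\<close>

lemma cycle_edge_integral:
  fixes I :: "'i set" and E :: "'e set"
  assumes CE: "cycle_edge_matrix I E G" and fin: "finite E"
    and S: "S \<subseteq> E" "column_matroid I (rat_mat G) S" and e: "e \<in> E"
    and d: "\<forall>i\<in>I. rat_mat G i e = (\<Sum>s\<in>S. d s * rat_mat G i s)" and s: "s \<in> S"
  shows "d s \<in> \<int>"
proof -
  let ?Q = "rat_mat G"
  obtain D :: "(nat, 'e) pre_digraph" and C where D: "arcs D = E"
    and C: "\<And>i. i \<in> I \<Longrightarrow> is_cycle D (C i)"
    and bij: "bij_betw (\<lambda>i. fst ` set (C i)) I {fst ` set c | c. is_cycle D c}"
    and G: "\<And>i e. i \<in> I \<Longrightarrow> e \<in> E \<Longrightarrow> G i e = cycle_vector (C i) e"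
    using CE unfolding cycle_edge_matrix_def by blast
  have row: "(\<Sum>x\<in>E. u x * ?Q i x) = (\<Sum>s\<leftarrow>C i. signed_value u s)" if i: "i \<in> I" for u i
  proof -
    have "(\<Sum>x\<in>E. u x * ?Q i x) = (\<Sum>x\<in>E. u x * of_int (cycle_vector (C i) x))"
      by (intro sum.cong) (auto simp: rat_mat_def G[OF i])
    also have "\<dots> = (\<Sum>s\<leftarrow>C i. signed_value u s)"
      using C[OF i] D fin by (intro sum_cycle_vector) (auto simp: is_cycle_def)
    finally show ?thesis .
  qed
  \<comment> \<open>The relation expressing column \<open>e\<close> through \<open>S\<close>, with
    rational coefficients, as a vector on all edges.\<close>
  define w where "w x = (if x = e then 1 else 0) - (if x \<in> S then d x else 0)" for x
  have orth: "(\<Sum>x\<in>E. w x * ?Q i x) = 0" if i: "i \<in> I" for i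
  proof -
    have "(\<Sum>x\<in>E. w x * ?Q i x) =
      (\<Sum>x\<in>E. (if x = e then 1 else 0) * ?Q i x) - (\<Sum>x\<in>E. (if x \<in> S then d x else 0) * ?Q i x)"
      by (simp add: w_def left_diff_distrib sum_subtractf)
    also have "(\<Sum>x\<in>E. (if x \<in> S then d x else 0) * ?Q i x) = (\<Sum>x\<in>S. d x * ?Q i x)"
      using S(1) fin by (intro sum.mono_neutral_cong_right) auto
    finally show ?thesis using d i sum_delta_mult[OF fin e, of "?Q i"] by simp
  qed
  \<comment> \<open>The matrix lists one traversal for each cycle edge set. The detour through a
    potential on that set transfers the vanishing to every other traversal.\<close>
  have "(\<Sum>s\<leftarrow>c. signed_value w s) = 0" if c: "is_cycle D c" for c
  proof -
    have "fst ` set c \<in> (\<lambda>i. fst ` set (C i)) ` I"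
      using bij c unfolding bij_betw_def by blast
    then obtain i where i: "i \<in> I" "fst ` set c = fst ` set (C i)" by auto
    then obtain \<pi> where "potential_on D (fst ` set c) \<pi> w"
      using cycle_potential[OF C[OF i(1)], of w] row[OF i(1), of w] orth[OF i(1)] by auto
    then show ?thesis by (rule sum_cycle_potential[OF c])
  qed
  then obtain \<pi> where \<pi>: "potential_on D E \<pi> w"
    using potential_exists[of E D w] D fin by auto
  \<comment> \<open>This is \<open>w\<close> minus the difference of the rounded-down potential. Off
    \<open>S\<close> the entries of \<open>w\<close> are 0 or 1, so there the fractional parts at
    the two ends agree and \<open>u\<close> vanishes.\<close>
  define u where "u x = frac (\<pi> (head D x)) - frac (\<pi> (tail D x))" for x
  have "u x = 0" if x: "x \<in> E - S" for x
  proof -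
    have "\<pi> (head D x) = \<pi> (tail D x) + of_int (if x = e then 1 else 0)"
      using \<pi> x by (auto simp: potential_on_def w_def split: if_splits)
    then show ?thesis by (simp add: u_def frac_def del: of_int_0 of_int_1)
  qed
  have "(\<Sum>x\<in>S. u x * ?Q i x) = 0" if i: "i \<in> I" for i
  proof -
    have "(\<Sum>x\<in>S. u x * ?Q i x) = (\<Sum>x\<in>E. u x * ?Q i x)"
      using S(1) fin \<open>\<And>x. x \<in> E - S \<Longrightarrow> u x = 0\<close> by (intro sum.mono_neutral_left) auto
    also have "\<dots> = (\<Sum>s\<leftarrow>C i. signed_value u s)" by (rule row[OF i])
    also have "\<dots> = 0"
      by (rule sum_cycle_potential[OF C[OF i], where \<pi> = "\<lambda>v. frac (\<pi> v)"])
        (simp add: potential_on_def u_def)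
    finally show ?thesis .
  qed
  then have "u s = 0" using S(2) s unfolding column_matroid_def by blast
  then have "w s = of_int (\<lfloor>\<pi> (head D s)\<rfloor> - \<lfloor>\<pi> (tail D s)\<rfloor>)"
    using \<pi> s S(1) by (auto simp: potential_on_def u_def frac_def)
  then have "w s \<in> \<int>" by (metis Ints_of_int)
  moreover have "d s = of_int (if s = e then 1 else 0) - w s" using s by (simp add: w_def)
  ultimately show ?thesis by (simp only: Ints_diff Ints_of_int)
qed

subsection \<open>The theorem\<close>

lemma int_smult_diff:
  fixes x :: "'a::ab_group_add"
  shows "int_smult (int a - int b) x = (\<Sum>i<a. x) - (\<Sum>i<b. x)"
proof -
  have add: "(\<Sum>i<m + n. x) = (\<Sum>i<m. x) + (\<Sum>i<n. x)" for m n :: nat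
    by (induction n) (simp_all add: add_ac)
  show ?thesis
  proof (cases "b \<le> a")
    case True
    then have "int_smult (int a - int b) x = (\<Sum>i<a - b. x)"
      by (simp add: int_smult_def nat_diff_distrib)
    also have "\<dots> = (\<Sum>i<a. x) - (\<Sum>i<b. x)"
      using add[of "a - b" b] True by simp
    finally show ?thesis .
  next
    case False
    then have "int_smult (int a - int b) x = - (\<Sum>i<b - a. x)"
      by (simp add: int_smult_def nat_diff_distrib)
    also have "\<dots> = (\<Sum>i<a. x) - (\<Sum>i<b. x)"
      using add[of "b - a" a] False by simp
    finally show ?thesis .
  qed
qed

lemma module_int_smult: "Modules.module (int_smult :: int \<Rightarrow> 'a::ab_group_add \<Rightarrow> 'a)"
proof
  fix m n :: int and x y :: 'a
  have add: "(\<Sum>i<a + b. x) = (\<Sum>i<a. x) + (\<Sum>i<b. x)" for a b :: nat and x :: 'a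
    by (induction b) (simp_all add: add_ac)
  have mult: "(\<Sum>i<a * b. x) = (\<Sum>i<a. \<Sum>i<b. x)" for a b :: nat
    by (induction a) (simp_all add: add add_ac)
  \<comment> \<open>Writing integers as differences of naturals reduces the module laws to repeated
    addition, without cases on signs.\<close>
  obtain a b where m: "m = int a - int b" by (metis int_diff_cases)
  obtain c d where n: "n = int c - int d" by (metis int_diff_cases)
  show "int_smult m (x + y) = int_smult m x + int_smult m y"
    by (simp add: m int_smult_diff sum.distrib)
  have "m + n = int (a + c) - int (b + d)" by (simp add: m n)
  then show "int_smult (m + n) x = int_smult m x + int_smult n x"
    by (simp only: int_smult_diff add) (simp add: m n int_smult_diff)
  have "m * n = int (a * c + b * d) - int (a * d + b * c)" by (simp add: m n algebra_simps)
  then show "int_smult m (int_smult n x) = int_smult (m * n) x"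
    by (simp only: int_smult_diff add) (simp add: m n int_smult_diff mult sum_subtractf)
  show "int_smult 1 x = x" by (simp add: int_smult_def)
qed

lemma module_vec_smult: "Modules.module ((*s) :: 'k::field \<Rightarrow> 'k ^ 'd \<Rightarrow> 'k ^ 'd)"
  by unfold_locales (simp_all add: Finite_Cartesian_Product.vec_eq_iff vector_smult_component algebra_simps)


theorem theorem3p1:
  fixes \<sigma> p s q :: nat
    and \<omega> :: complex
    and E :: "'e set"
    and I :: "'i set"
    and G :: "'i \<Rightarrow> 'e \<Rightarrow> int"
    and G' :: "'i \<Rightarrow> 'e \<Rightarrow> 'k::{field,finite}"
  assumes "\<sigma> > 1"
    and "primitive_root_of_unity \<sigma> \<omega>"
    and "finite E"
    and "finite I"
  shows
    "((vertex_edge_matrix I E G \<or> cycle_edge_matrix I E G \<or> totally_unimodular I E G) \<and>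
      q = CARD('a::{ab_group_add,finite}) \<longrightarrow>
        (let r = mat_rank I E (rat_mat G);
             \<O> = (\<lambda>k. flow_pairs E (group_flow I E G :: ('e \<Rightarrow> 'a) \<Rightarrow> bool) k \<sigma>)
         in (\<Sum>k = 0..\<sigma> - 1. \<omega> ^ k * of_nat (card (\<O> k))) =
            \<omega> ^ (card E - r) * (1 - \<omega>) ^ r * of_nat q ^ card E *
            rank_gen_poly E (column_matroid I (rat_mat G))
              (of_nat q * \<omega> / (1 - \<omega>)) ((1 - \<omega>) / \<omega>)))
     \<and>
     (prime p \<and> CARD('k) = p ^ s \<and> q = p ^ (s * CARD('d::finite)) \<longrightarrow>
        (let r = mat_rank I E G';
             \<O> = (\<lambda>k. flow_pairs E (field_flow I E G' :: ('e \<Rightarrow> 'k ^ 'd) \<Rightarrow> bool) k \<sigma>)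
         in (\<Sum>k = 0..\<sigma> - 1. \<omega> ^ k * of_nat (card (\<O> k))) =
            \<omega> ^ (card E - r) * (1 - \<omega>) ^ r * of_nat q ^ card E *
            rank_gen_poly E (column_matroid I G')
              (of_nat q * \<omega> / (1 - \<omega>)) ((1 - \<omega>) / \<omega>)))"
proof -
  have field: "(let r = mat_rank I E G'; \<O> = (\<lambda>k. flow_pairs E (field_flow I E G' :: ('e \<Rightarrow> 'k ^ 'd) \<Rightarrow> bool) k \<sigma>)
         in (\<Sum>k = 0..\<sigma> - 1. \<omega> ^ k * of_nat (card (\<O> k))) =
            \<omega> ^ (card E - r) * (1 - \<omega>) ^ r * of_nat q ^ card E *
            rank_gen_poly E (column_matroid I G')
              (of_nat q * \<omega> / (1 - \<omega>)) ((1 - \<omega>) / \<omega>))"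
    if "CARD('k) = p ^ s" "q = p ^ (s * CARD('d))"
  proof -
    have q: "q = CARD('k ^ 'd)" using that by (simp add: power_mult)
    \<comment> \<open>With \<open>\<phi>\<close> the identity on the field, every coefficient lies
      in its range.\<close>
    interpret integral_columns "(*s) :: 'k \<Rightarrow> 'k ^ 'd \<Rightarrow> 'k ^ 'd" "\<lambda>x. x" I E G'
      by (rule integral_columns.intro[OF module_vec_smult]) (unfold_locales, use assms(3) in auto)
    have "field_flow I E G' = flow"
      by (rule ext) (simp add: field_flow_def flow_def)
    then show ?thesis
      using sum_flow_pairs_rank_gen_poly[OF assms(1,2)]
      by (simp only: Let_def q mat_rank_def indep_def)
  qed
  have group: "(let r = mat_rank I E (rat_mat G); \<O> = (\<lambda>k. flow_pairs E (group_flow I E G :: ('e \<Rightarrow> 'a) \<Rightarrow> bool) k \<sigma>)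
         in (\<Sum>k = 0..\<sigma> - 1. \<omega> ^ k * of_nat (card (\<O> k))) =
            \<omega> ^ (card E - r) * (1 - \<omega>) ^ r * of_nat q ^ card E *
            rank_gen_poly E (column_matroid I (rat_mat G))
              (of_nat q * \<omega> / (1 - \<omega>)) ((1 - \<omega>) / \<omega>))"
    if G: "vertex_edge_matrix I E G \<or> cycle_edge_matrix I E G \<or> totally_unimodular I E G"
      and q: "q = CARD('a)"
  proof -
    have rat: "rat_mat G = (\<lambda>i e. of_int (G i e))" by (simp add: rat_mat_def)
    \<comment> \<open>Here \<open>integral\<close> says that the rational coefficients are integers,
      which the lemma for each of the three kinds of matrix supplies.\<close>
    interpret integral_columns "int_smult :: int \<Rightarrow> 'a \<Rightarrow> 'a" "of_int :: int \<Rightarrow> rat" I E G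
    proof (rule integral_columns.intro[OF module_int_smult])
      show "inj_comm_ring_hom (of_int :: int \<Rightarrow> rat)" by unfold_locales
      show "integral_columns_axioms (of_int :: int \<Rightarrow> rat) I E G"
      proof
        fix S e s and d :: "'e \<Rightarrow> rat"
        assume "S \<subseteq> E" "column_matroid I (\<lambda>i e. of_int (G i e) :: rat) S" "e \<in> E"
          "\<forall>i\<in>I. of_int (G i e) = (\<Sum>s\<in>S. d s * of_int (G i s))" "s \<in> S"
        then have "d s \<in> \<int>"
          using G vertex_edge_integral[of I E G S e d s] cycle_edge_integral[of I E G S e d s]
            totally_unimodular_integral[of I E G S e d s] assms(3,4)
          unfolding rat by argo
        then show "d s \<in> range of_int" unfolding Ints_def .
      qed (rule assms(3))
    qed
    have "group_flow I E G = flow"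
      by (rule ext) (simp add: group_flow_def flow_def rat_mat_def)
    then show ?thesis
      using sum_flow_pairs_rank_gen_poly[OF assms(1,2)]
      by (simp only: Let_def q mat_rank_def indep_def rat)
  qed
  show ?thesis using field group by blast
qed

end
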